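(* The following 48 elements form a minimal generating set of the $\mathbb{C}$-algebra $C_{33}$: $t_a=\mathrm{tr}(X)$, $t_b=\mathrm{tr}(Y)$, $t_c=\mathrm{tr}(Z)$, $t_{1}=\mathrm{tr}(x^2)$, $t_2=\mathrm{tr}(y^2)$, $t_3=\mathrm{tr}(z^2)$, $t_4=\mathrm{tr}(xy)$, $t_5=\mathrm{tr}(xz)$, $t_6=\mathrm{tr}(yz)$, $t_7=\mathrm{tr}(x^3)$, $t_8=\mathrm{tr}(y^3)$, $t_9=\mathrm{tr}(z^3)$, $t_{10}=\mathrm{tr}(x^2y)$, $t_{11}=\mathrm{tr}(x^2z)$, $t_{12}=\mathrm{tr}(y^2x)$, $t_{13}=\mathrm{tr}(y^2z)$, $t_{14}=\mathrm{tr}(z^2x)$, $t_{15}=\mathrm{tr}(z^2y)$, $t_{16}=\mathrm{tr}(xyz)+\mathrm{tr}(xzy)$, $t_{17}=\mathrm{tr}(xyz)-\mathrm{tr}(xzy)$, $t_{18}=\mathrm{tr}(x^2y^2)-\mathrm{tr}(xyxy)$, $t_{19}=\mathrm{tr}(x^2z^2)-\mathrm{tr}(xzxz)$, $t_{20}=\mathrm{tr}(y^2z^2)-\mathrm{tr}(yzyz)$, $t_{21}=\mathrm{tr}(x^2yz)+\mathrm{tr}(x^2zy)-2\mathrm{tr}(xyxz)$, $t_{22}=\mathrm{tr}(y^2xz)+\mathrm{tr}(y^2zx)-2\mathrm{tr}(yxyz)$, $t_{23}=\mathrm{tr}(z^2xy)+\mathrm{tr}(z^2yx)-2\mathrm{tr}(zxzy)$,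 $t_{24}=\mathrm{tr}(x^2yz)-\mathrm{tr}(x^2zy)$, $t_{25}=\mathrm{tr}(y^2xz)-\mathrm{tr}(y^2zx)$, $t_{26}=\mathrm{tr}(z^2xy)-\mathrm{tr}(z^2yx)$, $t_{27}=\mathrm{tr}(x^2yxz)-\mathrm{tr}(x^2zxy)$, $t_{28}=\mathrm{tr}(y^2xyz)-\mathrm{tr}(y^2zyx)$, $t_{29}=\mathrm{tr}(z^2yzx)-\mathrm{tr}(z^2xzy)$, $t_{30}=\mathrm{tr}(yxyxz)+\mathrm{tr}(x^2y^2z)-\mathrm{tr}(xyzxy)-\mathrm{tr}(x^2zy^2)$, $t_{31}=\mathrm{tr}(zxzxy)+\mathrm{tr}(x^2z^2y)-\mathrm{tr}(xzyxz)-\mathrm{tr}(x^2yz^2)$, $t_{32}=\mathrm{tr}(yzyzx)+\mathrm{tr}(z^2y^2x)-\mathrm{tr}(zyxzy)-\mathrm{tr}(z^2xy^2)$, $t_{33}=\mathrm{tr}(x^2y^2z)+\mathrm{tr}(x^2zy^2)+\mathrm{tr}(xyxyz)+\mathrm{tr}(xyxzy)-2\mathrm{tr}(x^2yzy)-2\mathrm{tr}(xy^2xz)$, $t_{34}=\mathrm{tr}(x^2z^2y)+\mathrm{tr}(x^2yz^2)+\mathrm{tr}(xzxzy)+\mathrm{tr}(xzxyz)-2\mathrm{tr}(x^2zyz)-2\mathrm{tr}(xz^2xy)$, $t_{35}=\mathrm{tr}(y^2z^2x)+\mathrm{tr}(y^2xz^2)+\mathrm{tr}(yzyzx)+\mathrm{tr}(yzyxz)-2\mathrm{tr}(y^2zxz)-2\mathrm{tr}(yz^2yx)$,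 $t_{36}=\mathrm{tr}(x^2y^2xy)-\mathrm{tr}(y^2x^2yx)$, $t_{37}=\mathrm{tr}(x^2z^2xz)-\mathrm{tr}(z^2x^2zx)$, $t_{38}=\mathrm{tr}(y^2z^2yz)-\mathrm{tr}(z^2y^2zy)$, $t_{39}=\mathrm{tr}(x^2yxyz)+\mathrm{tr}(x^2yxzy)+\mathrm{tr}(x^2zxy^2)-\mathrm{tr}(x^2y^2xz)-\mathrm{tr}(x^2yzxy)-\mathrm{tr}(x^2zyxy)$, $t_{40}=\mathrm{tr}(y^2xyxz)+\mathrm{tr}(y^2xyzx)+\mathrm{tr}(y^2zyx^2)-\mathrm{tr}(y^2x^2yz)-\mathrm{tr}(y^2xzyx)-\mathrm{tr}(y^2zxyx)$, $t_{41}=\mathrm{tr}(z^2yzyx)+\mathrm{tr}(z^2yzxy)+\mathrm{tr}(z^2xzy^2)-\mathrm{tr}(z^2y^2zx)-\mathrm{tr}(z^2yxzy)-\mathrm{tr}(z^2xyzy)$, $t_{42}=\mathrm{tr}(x^2zxzy)+\mathrm{tr}(x^2zxyz)+\mathrm{tr}(x^2yxz^2)-\mathrm{tr}(x^2z^2xy)-\mathrm{tr}(x^2zyxz)-\mathrm{tr}(x^2yzxz)$, $t_{43}=\mathrm{tr}(y^2zyzx)+\mathrm{tr}(y^2zyxz)+\mathrm{tr}(y^2xyz^2)-\mathrm{tr}(y^2z^2yx)-\mathrm{tr}(y^2zxyz)-\mathrm{tr}(y^2xzyz)$, $t_{44}=\mathrm{tr}(z^2xzxy)+\mathrm{tr}(z^2xzyx)+\mathrm{tr}(z^2yzx^2)-\mathrm{tr}(z^2x^2zy)-\mathrm{tr}(z^2xyzx)-\mathrm{tr}(z^2yxzx)$,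 $t_{45}=\mathrm{tr}(x^2y^2z^2)+\mathrm{tr}(x^2zyzy)+\mathrm{tr}(xyxz^2y)+\mathrm{tr}(xyzxyz)+\mathrm{tr}(xzxzy^2)-\mathrm{tr}(x^2yzyz)-\mathrm{tr}(x^2z^2y^2)-\mathrm{tr}(xyxyz^2)-\mathrm{tr}(xy^2zxz)-\mathrm{tr}(xzyxzy)$.
   Context: $X,Y,Z$ are generic $3\times3$ matrices over $\mathbb{C}$ (their 27 entries are independent variables), and $C_{33}$ is the $\mathbb{C}$-algebra generated by the traces of all nonempty products of $X,Y,Z$; it is the ring of polynomial invariants of $\mathrm{GL}_3(\mathbb{C})$ acting on triples of $3\times 3$ matrices by simultaneous conjugation. It is graded, the trace of a product of $k$ generic matrices having degree $k$. The corresponding traceless generic matrices are $x=X-\tfrac13\mathrm{tr}(X)E$, $y=Y-\tfrac13\mathrm{tr}(Y)E$, $z=Z-\tfrac13\mathrm{tr}(Z)E$, with $E$ the identity matrix. A minimal generating set is a set of homogeneous elements generating $C_{33}$ as a $\mathbb{C}$-algebra such that no proper subset generates it. *)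

theory Defs
  imports "HOL-Analysis.Determinants" "HOL-Library.Poly_Mapping"
begin

datatype letter = LX | LY | LZ

text \<open>The index \<open>(l, i, j)\<close> names the \<open>(i, j)\<close> entry of the generic matrix \<open>l\<close>;
  \<open>mpoly\<close> is the polynomial ring over the complex numbers in these 27 independent variables.
  A monomial is its exponent vector, a polynomial maps monomials to coefficients, and the
  multiplication of \<^theory>\<open>HOL-Library.Poly_Mapping\<close> is the convolution product.\<close>

type_synonym var = "letter \<times> 3 \<times> 3"
type_synonym monomial = "var \<Rightarrow>\<^sub>0 nat"
type_synonym mpoly = "monomial \<Rightarrow>\<^sub>0 complex"

definition Const :: "complex \<Rightarrow> mpoly" where
  "Const c = Poly_Mapping.single 0 c"

definition Var :: "var \<Rightarrow> mpoly" where
  "Var v = Poly_Mapping.single (Poly_Mapping.single v 1) 1"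

definition generic :: "letter \<Rightarrow> mpoly^3^3" where
  "generic l = (\<chi> i j. Var (l, i, j))"

definition traceless :: "mpoly^3^3 \<Rightarrow> mpoly^3^3" where
  "traceless A = A - mat (Const (1/3) * trace A)"

definition tr :: "(mpoly^3^3) list \<Rightarrow> mpoly" where
  "tr As = trace (foldr (**) As (mat 1))"

definition subalgebra :: "mpoly set \<Rightarrow> bool" where
  "subalgebra B \<longleftrightarrow> (\<forall>c. Const c \<in> B) \<and> (\<forall>p\<in>B. \<forall>q\<in>B. p + q \<in> B \<and> p * q \<in> B)"

definition C33 :: "mpoly set" where
  "C33 = subalgebra hull {tr (map generic w) | w. w \<noteq> []}"

definition monomial_degree :: "monomial \<Rightarrow> nat" where
  "monomial_degree m = (\<Sum>v\<in>Poly_Mapping.keys m. Poly_Mapping.lookup m v)"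

text \<open>\<open>C33\<close> is graded by the total degree of polynomials: the trace of a product of \<open>k\<close> generic
  matrices is homogeneous of degree \<open>k\<close> in their entries. The zero polynomial is homogeneous.\<close>

definition homogeneous :: "mpoly \<Rightarrow> bool" where
  "homogeneous p \<longleftrightarrow> (\<exists>d. \<forall>m\<in>Poly_Mapping.keys p. monomial_degree m = d)"

definition minimal_generating_set :: "mpoly set \<Rightarrow> mpoly set \<Rightarrow> bool" where
  "minimal_generating_set R S \<longleftrightarrow>
     S \<subseteq> R \<and> (\<forall>p\<in>S. homogeneous p) \<and>
     subalgebra hull S = R \<and> (\<forall>S'. S' \<subset> S \<longrightarrow> subalgebra hull S' \<noteq> R)"

text \<open>In order: \<open>t\<^sub>a\<close>, \<open>t\<^sub>b\<close>, \<open>t\<^sub>c\<close>, followed by \<open>t\<^sub>1\<close> to \<open>t\<^sub>4\<^sub>5\<close>.\<close>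

definition t_list :: "mpoly list" where
  "t_list =
     (let X = generic LX; Y = generic LY; Z = generic LZ;
          x = traceless X; y = traceless Y; z = traceless Z
      in [
         tr [X],
         tr [Y],
         tr [Z],
         tr [x, x],
         tr [y, y],
         tr [z, z],
         tr [x, y],
         tr [x, z],
         tr [y, z],
         tr [x, x, x],
         tr [y, y, y],
         tr [z, z, z],
         tr [x, x, y],
         tr [x, x, z],
         tr [y, y, x],
         tr [y, y, z],
         tr [z, z, x],
         tr [z, z, y],
         tr [x, y, z] + tr [x, z, y],
         tr [x, y, z] - tr [x, z, y],
         tr [x, x, y, y] - tr [x, y, x, y],
         tr [x, x, z, z] - tr [x, z, x, z],
         tr [y, y, z, z] - tr [y, z, y, z],
         tr [x, x, y, z] + tr [x, x, z, y] - 2 * tr [x, y, x, z],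
         tr [y, y, x, z] + tr [y, y, z, x] - 2 * tr [y, x, y, z],
         tr [z, z, x, y] + tr [z, z, y, x] - 2 * tr [z, x, z, y],
         tr [x, x, y, z] - tr [x, x, z, y],
         tr [y, y, x, z] - tr [y, y, z, x],
         tr [z, z, x, y] - tr [z, z, y, x],
         tr [x, x, y, x, z] - tr [x, x, z, x, y],
         tr [y, y, x, y, z] - tr [y, y, z, y, x],
         tr [z, z, y, z, x] - tr [z, z, x, z, y],
         tr [y, x, y, x, z] + tr [x, x, y, y, z] - tr [x, y, z, x, y] - tr [x, x, z, y, y],
         tr [z, x, z, x, y] + tr [x, x, z, z, y] - tr [x, z, y, x, z] - tr [x, x, y, z, z],
         tr [y, z, y, z, x] + tr [z, z, y, y, x] - tr [z, y, x, z, y] - tr [z, z, x, y, y],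
         tr [x, x, y, y, z] + tr [x, x, z, y, y] + tr [x, y, x, y, z] + tr [x, y, x, z, y]
           - 2 * tr [x, x, y, z, y] - 2 * tr [x, y, y, x, z],
         tr [x, x, z, z, y] + tr [x, x, y, z, z] + tr [x, z, x, z, y] + tr [x, z, x, y, z]
           - 2 * tr [x, x, z, y, z] - 2 * tr [x, z, z, x, y],
         tr [y, y, z, z, x] + tr [y, y, x, z, z] + tr [y, z, y, z, x] + tr [y, z, y, x, z]
           - 2 * tr [y, y, z, x, z] - 2 * tr [y, z, z, y, x],
         tr [x, x, y, y, x, y] - tr [y, y, x, x, y, x],
         tr [x, x, z, z, x, z] - tr [z, z, x, x, z, x],
         tr [y, y, z, z, y, z] - tr [z, z, y, y, z, y],
         tr [x, x, y, x, y, z] + tr [x, x, y, x, z, y] + tr [x, x, z, x, y, y]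
           - tr [x, x, y, y, x, z] - tr [x, x, y, z, x, y] - tr [x, x, z, y, x, y],
         tr [y, y, x, y, x, z] + tr [y, y, x, y, z, x] + tr [y, y, z, y, x, x]
           - tr [y, y, x, x, y, z] - tr [y, y, x, z, y, x] - tr [y, y, z, x, y, x],
         tr [z, z, y, z, y, x] + tr [z, z, y, z, x, y] + tr [z, z, x, z, y, y]
           - tr [z, z, y, y, z, x] - tr [z, z, y, x, z, y] - tr [z, z, x, y, z, y],
         tr [x, x, z, x, z, y] + tr [x, x, z, x, y, z] + tr [x, x, y, x, z, z]
           - tr [x, x, z, z, x, y] - tr [x, x, z, y, x, z] - tr [x, x, y, z, x, z],
         tr [y, y, z, y, z, x] + tr [y, y, z, y, x, z] + tr [y, y, x, y, z, z]
           - tr [y, y, z, z, y, x] - tr [y, y, z, x, y, z] - tr [y, y, x, z, y, z],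
         tr [z, z, x, z, x, y] + tr [z, z, x, z, y, x] + tr [z, z, y, z, x, x]
           - tr [z, z, x, x, z, y] - tr [z, z, x, y, z, x] - tr [z, z, y, x, z, x],
         tr [x, x, y, y, z, z] + tr [x, x, z, y, z, y] + tr [x, y, x, z, z, y]
           + tr [x, y, z, x, y, z] + tr [x, z, x, z, y, y] - tr [x, x, y, z, y, z]
           - tr [x, x, z, z, y, y] - tr [x, y, x, y, z, z] - tr [x, y, y, z, x, z]
           - tr [x, z, y, x, z, y]])"

end

theory Submission
  imports Defs
begin

text \<open>Generation. Let \<open>B\<close> be a subalgebra containing the 48 elements and let \<open>n\<close> be minimal such
  that the trace of some word of length \<open>n\<close> in \<open>x, y, z\<close> is not in \<open>B\<close>. Choose an additive real
  functional that vanishes on \<open>B\<close> but not on this trace. As a function of words of length \<open>n\<close> it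
  is cyclic and, by the polarised Cayley--Hamilton identity, satisfies all consequences of
  \<open>a\<^sup>3 = 0\<close>. These allow one to merge two occurrences of a letter into its square. For \<open>n \<ge> 7\<close>
  this kills every word that contains a letter three times, and hence every word; for \<open>n \<le> 6\<close> it
  leaves a short list of words, on which the functional vanishes since it vanishes on the generators.

  Minimality. For a generator \<open>t\<close> of multidegree \<open>d\<close> we give a triple of matrices at which \<open>t\<close> does
  not vanish, while every other generator of multidegree \<open>d\<close> or of degree at most \<open>|d| / 2\<close> does.
  Every product of two polynomials without constant term in the other generators then has vanishing
  component of multidegree \<open>d\<close> at this triple.\<close>

section \<open>Cyclic functionals on words satisfying the identity of nilpotency index three\<close>

text \<open>Models traces of words of length \<open>n\<close> modulo products of traces of shorter
  words. The word \<open>d\<close> has to be nonempty: with D = 1 the right side of the fundamental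
  trace identity contains 3 tr(ABC), which is not a product of shorter traces.\<close>

locale nil_functional =
  fixes F :: "'a list \<Rightarrow> real" and n :: nat
  assumes cyclic: "F (u @ v) = F (v @ u)"
    and symm: "\<lbrakk>a \<noteq> []; b \<noteq> []; c \<noteq> []; d \<noteq> []; length (a @ b @ c @ d) = n\<rbrakk> \<Longrightarrow>
      F (a @ b @ c @ d) + F (a @ c @ b @ d) + F (b @ a @ c @ d) + F (b @ c @ a @ d)
        + F (c @ a @ b @ d) + F (c @ b @ a @ d) = 0"
begin

text \<open>Two equal arguments in \<open>symm\<close> double each of three terms, and the factor 2
  cancels.\<close>

lemma merge:
  assumes "a \<noteq> []" "b \<noteq> []" "d \<noteq> []" "length (a @ b @ a @ d) = n"
  shows "F (a @ b @ a @ d) = - F (a @ a @ b @ d) - F (b @ a @ a @ d)"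
  using symm[of a a b d] assms by simp

lemma cube:
  assumes "a \<noteq> []" "d \<noteq> []" "length (a @ a @ a @ d) = n"
  shows "F (a @ a @ a @ d) = 0"
  using symm[of a a a d] assms by simp

lemma cube_Cons: "v \<noteq> [] \<Longrightarrow> length v + 3 = n \<Longrightarrow> F (x # x # x # v) = 0"
  using cube[of "[x]" v] by simp

text \<open>Merging the outer letters of x(xu)x(xv) leaves two words, each of which contains a cube
  of \<open>x\<close> up to rotation.\<close>

lemma square_square:
  assumes "u \<noteq> []" "length u + length v + 4 = n"
  shows "F (x # x # u @ x # x # v) = 0"
proof -
  have 1: "F ([x] @ (x # u) @ [x] @ (x # v)) =
    - F ([x] @ [x] @ (x # u) @ (x # v)) - F ((x # u) @ [x] @ [x] @ (x # v))"
    by (rule merge) (use assms in auto)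
  have 2: "F (x # x # x # u @ x # v) = 0"
    by (rule cube_Cons) (use assms in auto)
  have 3: "F (x # u @ x # x # x # v) = F (x # x # x # v @ x # u)"
    using cyclic[of "x # u" "x # x # x # v"] by simp
  have 4: "F (x # x # x # v @ x # u) = 0"
    by (rule cube_Cons) (use assms in auto)
  show ?thesis using 1 2 3 4 by simp
qed

text \<open>Merging x(xu)xv gives one word with a cube, which vanishes, and one that is a rotation
  of the word with \<open>u\<close> and \<open>v\<close> exchanged. Write S(u,v) for the value of F
  on xxuxv; then S is antisymmetric.\<close>

lemma sandwich_antisym:
  assumes "u \<noteq> []" "v \<noteq> []" "length u + length v + 3 = n"
  shows "F (x # x # u @ x # v) = - F (x # x # v @ x # u)"
proof -
  have 1: "F ([x] @ (x # u) @ [x] @ v) =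
    - F ([x] @ [x] @ (x # u) @ v) - F ((x # u) @ [x] @ [x] @ v)"
    by (rule merge) (use assms in auto)
  have 2: "F (x # x # x # u @ v) = 0"
    by (rule cube_Cons) (use assms in auto)
  have 3: "F (x # u @ x # x # v) = F (x # x # v @ x # u)"
    using cyclic[of "x # u" "x # x # v"] by simp
  show ?thesis using 1 2 3 by simp
qed

lemma three_letters:
  assumes "u \<noteq> []" "v \<noteq> []" "w \<noteq> []" "length u + length v + length w + 3 = n"
  shows "F (x # u @ x # v @ x # w) = - F (x # x # (u @ v) @ x # w) - F (x # x # v @ x # (w @ u))"
proof -
  have "F ([x] @ u @ [x] @ (v @ x # w)) =
    - F ([x] @ [x] @ u @ (v @ x # w)) - F (u @ [x] @ [x] @ (v @ x # w))"
    by (rule merge) (use assms in auto)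
  moreover have "F (u @ [x] @ [x] @ (v @ x # w)) = F (x # x # v @ x # (w @ u))"
    using cyclic[of u "[x] @ [x] @ (v @ x # w)"] by simp
  ultimately show ?thesis by simp
qed

text \<open>The cyclic word \<open>x u x v x w\<close> can be reduced by merging any two of its three letters
  \<open>x\<close>; comparing the outcomes gives this symmetry.\<close>

lemma sandwich_cyclic:
  assumes "u \<noteq> []" "v \<noteq> []" "w \<noteq> []" "length u + length v + length w + 3 = n"
  shows "F (x # x # (u @ v) @ x # w) = F (x # x # (v @ w) @ x # u)"
proof -
  have len: "length v + length w + length u + 3 = n" "length w + length u + length v + 3 = n"
    using assms by auto
  have r1: "F (x # v @ x # w @ x # u) = F (x # u @ x # v @ x # w)"
    using cyclic[of "x # u" "x # v @ x # w"] by simp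
  have r2: "F (x # w @ x # u @ x # v) = F (x # u @ x # v @ x # w)"
    using cyclic[of "x # w" "x # u @ x # v"] by simp
  have len': "length v + length (w @ u) + 3 = n" "length w + length (u @ v) + 3 = n"
     "length u + length (v @ w) + 3 = n"
    using assms by auto
  have ne: "w @ u \<noteq> []" "u @ v \<noteq> []" "v @ w \<noteq> []" using assms by auto
  show ?thesis
    using three_letters[OF assms, of x] three_letters[OF assms(2,3,1) len(1), of x]
      three_letters[OF assms(3,1,2) len(2), of x]
      sandwich_antisym[OF assms(2) ne(1) len'(1), of x]
      sandwich_antisym[OF assms(3) ne(2) len'(2), of x]
      sandwich_antisym[OF assms(1) ne(3) len'(3), of x] r1 r2
    by linarith
qed

text \<open>Four applications of the cyclic symmetry lead through S(pq,rs) = S(qrs,p) = S(sp,qr) =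
  S(pqr,s) = S(rs,pq), the negative of the first value by antisymmetry.\<close>

lemma sandwich_two_two:
  assumes "p \<noteq> []" "q \<noteq> []" "r \<noteq> []" "s \<noteq> []" "length p + length q + length r + length s + 3 = n"
  shows "F (x # x # (p @ q) @ x # (r @ s)) = 0"
proof -
  have 1: "F (x # x # (p @ q) @ x # (r @ s)) = F (x # x # (q @ (r @ s)) @ x # p)"
    by (rule sandwich_cyclic) (use assms in auto)
  have 2: "F (x # x # (s @ p) @ x # (q @ r)) = F (x # x # (p @ (q @ r)) @ x # s)"
    by (rule sandwich_cyclic) (use assms in auto)
  have 3: "F (x # x # ((q @ r) @ s) @ x # p) = F (x # x # (s @ p) @ x # (q @ r))"
    by (rule sandwich_cyclic) (use assms in auto)
  have 4: "F (x # x # ((p @ q) @ r) @ x # s) = F (x # x # (r @ s) @ x # (p @ q))"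
    by (rule sandwich_cyclic) (use assms in auto)
  have 5: "F (x # x # (p @ q) @ x # (r @ s)) = - F (x # x # (r @ s) @ x # (p @ q))"
    by (rule sandwich_antisym) (use assms in auto)
  show ?thesis using 1 2 3 4 5 by simp
qed

text \<open>This value is one link in the chain that starts with a split into two and two.\<close>

lemma sandwich_one_three:
  assumes "p \<noteq> []" "q \<noteq> []" "r \<noteq> []" "s \<noteq> []" "length p + length q + length r + length s + 3 = n"
  shows "F (x # x # (p @ q @ r) @ x # s) = 0"
proof -
  have "F (x # x # (s @ p) @ x # (q @ r)) = F (x # x # (p @ (q @ r)) @ x # s)"
    by (rule sandwich_cyclic) (use assms in auto)
  then show ?thesis using sandwich_two_two[of s p q r x] assms by simp
qed

text \<open>The bound 7 is where \<open>u\<close> and \<open>v\<close> have total length at least 4,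
  so that one has length at least 3 or both have length 2.\<close>

lemma sandwich_long:
  assumes "n \<ge> 7" "u \<noteq> []" "v \<noteq> []" "length u + length v + 3 = n"
  shows "F (x # x # u @ x # v) = 0"
proof -
  have long: "F (x # x # u' @ x # v') = 0"
    if l: "length u' \<ge> 3" "v' \<noteq> []" "length u' + length v' + 3 = n" for u' v'
  proof -
    obtain a b c where "u' = a # b # c" "c \<noteq> []"
      using l(1) by (cases u' rule: list.exhaust; cases "tl u'"; cases "tl (tl u')") auto
    then show ?thesis
      using sandwich_one_three[of "[a]" "[b]" c v' x] l by simp
  qed
  consider "length u \<ge> 3" | "length v \<ge> 3" | "length u = 2" "length v = 2"
    using assms by linarith
  then show ?thesis
  proof cases
    case 1
    then show ?thesis using long assms by blast
  next
    case 2
    then show ?thesis using long[of v u] sandwich_antisym[of u v x] assms by simp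
  next
    case 3
    then obtain p q r s where "u = [p, q]" "v = [r, s]"
      by (auto simp: length_Suc_conv eval_nat_numeral)
    then show ?thesis
      using sandwich_two_two[of "[p]" "[q]" "[r]" "[s]" x] assms by simp
  qed
qed

text \<open>The cyclic word is cut at three occurrences of \<open>x\<close>. If two of them are
  adjacent, a rotation already has the form xxuxv; otherwise one merge produces two words of this
  form.\<close>

lemma count_three:
  assumes "n \<ge> 4" "length w = n" "count_list w x \<ge> 3"
    and sandwich: "\<And>u v. \<lbrakk>u \<noteq> []; v \<noteq> []; length u + length v + 3 = n\<rbrakk> \<Longrightarrow> F (x # x # u @ x # v) = 0"
  shows "F w = 0"
proof -
  have split: "\<exists>u v. w' = u @ x # v \<and> count_list v x + 1 = count_list w' x"
    if "count_list w' x \<noteq> 0" for w'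
  proof -
    have "x \<in> set w'" using that by (simp add: count_list_0_iff)
    then obtain u v where uv: "w' = u @ x # v" "x \<notin> set u"
      by (blast dest: split_list_first)
    then show ?thesis by (intro exI[of _ u] exI[of _ v]) (simp add: count_list_0_iff)
  qed
  have "count_list w x \<noteq> 0" using assms(3) by simp
  from split[OF this] obtain p w1 where 1: "w = p @ x # w1" "count_list w1 x + 1 = count_list w x"
    by blast
  have "count_list w1 x \<noteq> 0" using 1(2) assms(3) by simp
  from split[OF this] obtain u w2 where 2: "w1 = u @ x # w2" "count_list w2 x + 1 = count_list w1 x"
    by blast
  have "count_list w2 x \<noteq> 0" using 1(2) 2(2) assms(3) by simp
  from split[OF this] obtain v q where 3: "w2 = v @ x # q"
    by blast
  \<comment> \<open>Cyclically, the end and the beginning of \<open>w\<close> form a single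
    gap.\<close>
  define r where "r = q @ p"
  have Fw: "F w = F (x # u @ x # v @ x # r)"
    using cyclic[of p "x # u @ x # v @ x # q"] by (simp add: 1 2 3 r_def)
  have len: "length u + length v + length r + 3 = n"
    using assms(2) by (simp add: 1 2 3 r_def)
  \<comment> \<open>If one gap is empty, the three letters are cyclically adjacent and form a cube;
    \<open>n \<ge> 4\<close> keeps the rest of the word nonempty.\<close>
  have pair: "F (x # x # u' @ x # v') = 0" if "length u' + length v' + 3 = n" for u' v'
  proof (cases "u' = [] \<or> v' = []")
    case True
    moreover have "F (x # x # u' @ [x]) = F (x # x # x # u')"
      using cyclic[of "x # x # u'" "[x]"] by simp
    ultimately show ?thesis
      using cube_Cons[of u' x] cube_Cons[of v' x] that assms(1) by (cases u'; cases v') auto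
  qed (use sandwich that in blast)
  have cyc: "F (x # u @ x # v @ x # r) = F (x # v @ x # r @ x # u)"
     "F (x # u @ x # v @ x # r) = F (x # r @ x # u @ x # v)"
    using cyclic[of "x # u" "x # v @ x # r"] cyclic[of "x # u @ x # v" "x # r"] by simp_all
  consider "u = []" | "v = []" | "r = []" | "u \<noteq> []" "v \<noteq> []" "r \<noteq> []" by blast
  then show ?thesis
  proof cases
    case 1
    then show ?thesis using Fw pair[of v r] len by simp
  next
    case 2
    then show ?thesis using Fw cyc pair[of r u] len by simp
  next
    case 3
    then show ?thesis using Fw cyc pair[of u v] len by simp
  next
    case 4
    then show ?thesis
      using Fw three_letters[OF 4 len, of x] pair[of "u @ v" r] pair[of v "r @ u"] len by simp
  qed
qed

lemma rotate_eq: "F (rotate k w) = F w"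
  by (metis append_take_drop_id cyclic rotate_drop_take)

lemma merge_Cons:
  assumes "b \<noteq> []" "d \<noteq> []" "length b + length d + 2 = n"
  shows "F (x # b @ x # d) + F (x # x # b @ d) + F (b @ x # x # d) = 0"
  using merge[of "[x]" b d] assms by simp

text \<open>By antisymmetry the degree five generator is twice one of its words.\<close>

lemma sandwich_five:
  assumes "n = 5" and "F [a, a, b, a, c] - F [a, a, c, a, b] = 0"
  shows "F [a, a, b, a, c] = 0 \<and> F [a, a, c, a, b] = 0"
  using sandwich_antisym[of "[b]" "[c]" a] assms by simp

lemma sandwich_self: "u \<noteq> [] \<Longrightarrow> n = length u + length u + 3 \<Longrightarrow> F (a # a # u @ a # u) = 0"
  using sandwich_antisym[of u u a] by simp

text \<open>The word bbaaba is a rotation of aababb, the negative of aabbab by antisymmetry, so the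
  generator is twice one word.\<close>

lemma sandwich_bbb:
  assumes n: "n = 6" and t: "F [a, a, b, b, a, b] - F [b, b, a, a, b, a] = 0"
  shows "F [a, a, b, a, b, b] = 0 \<and> F [b, b, a, b, a, a] = 0"
  using t sandwich_antisym[of "[b]" "[b, b]" a] sandwich_antisym[of "[a]" "[a, a]" b]
    cyclic[of "[b, b]" "[a, a, b, a]"] n
  by simp

text \<open>Antisymmetry and cyclic symmetry identify S(b,bc), S(b,cb), S(c,bb) with each other and
  with the negatives of the subtracted terms: the generator is six times one word.\<close>

lemma sandwich_bbc:
  assumes n: "n = 6"
    and t: "F [a, a, b, a, b, c] + F [a, a, b, a, c, b] + F [a, a, c, a, b, b]
      - F [a, a, b, b, a, c] - F [a, a, b, c, a, b] - F [a, a, c, b, a, b] = 0"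
  shows "F [a, a, b, a, b, c] = 0 \<and> F [a, a, b, a, c, b] = 0 \<and> F [a, a, c, a, b, b] = 0"
  using t sandwich_antisym[of "[b]" "[b, c]" a] sandwich_antisym[of "[b]" "[c, b]" a]
    sandwich_antisym[of "[c]" "[b, b]" a] sandwich_cyclic[of "[b]" "[b]" "[c]" a]
    sandwich_cyclic[of "[b]" "[c]" "[b]" a] n
  by simp

end

text \<open>Row \<open>i\<close>, counted from \<open>0\<close>, encodes \<open>t\<^sub>i\<^sub>+\<^sub>1\<close>, the entry \<open>i + 3\<close> of \<open>t_list\<close>.\<close>

definition t_rows :: "(int \<times> letter list) list list" where
  "t_rows = [
  [(1, [LX, LX])],
  [(1, [LY, LY])],
  [(1, [LZ, LZ])],
  [(1, [LX, LY])],
  [(1, [LX, LZ])],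
  [(1, [LY, LZ])],
  [(1, [LX, LX, LX])],
  [(1, [LY, LY, LY])],
  [(1, [LZ, LZ, LZ])],
  [(1, [LX, LX, LY])],
  [(1, [LX, LX, LZ])],
  [(1, [LY, LY, LX])],
  [(1, [LY, LY, LZ])],
  [(1, [LZ, LZ, LX])],
  [(1, [LZ, LZ, LY])],
  [(1, [LX, LY, LZ]), (1, [LX, LZ, LY])],
  [(1, [LX, LY, LZ]), (-1, [LX, LZ, LY])],
  [(1, [LX, LX, LY, LY]), (-1, [LX, LY, LX, LY])],
  [(1, [LX, LX, LZ, LZ]), (-1, [LX, LZ, LX, LZ])],
  [(1, [LY, LY, LZ, LZ]), (-1, [LY, LZ, LY, LZ])],
  [(1, [LX, LX, LY, LZ]), (1, [LX, LX, LZ, LY]), (-2, [LX, LY, LX, LZ])],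
  [(1, [LY, LY, LX, LZ]), (1, [LY, LY, LZ, LX]), (-2, [LY, LX, LY, LZ])],
  [(1, [LZ, LZ, LX, LY]), (1, [LZ, LZ, LY, LX]), (-2, [LZ, LX, LZ, LY])],
  [(1, [LX, LX, LY, LZ]), (-1, [LX, LX, LZ, LY])],
  [(1, [LY, LY, LX, LZ]), (-1, [LY, LY, LZ, LX])],
  [(1, [LZ, LZ, LX, LY]), (-1, [LZ, LZ, LY, LX])],
  [(1, [LX, LX, LY, LX, LZ]), (-1, [LX, LX, LZ, LX, LY])],
  [(1, [LY, LY, LX, LY, LZ]), (-1, [LY, LY, LZ, LY, LX])],
  [(1, [LZ, LZ, LY, LZ, LX]), (-1, [LZ, LZ, LX, LZ, LY])],
  [(1, [LY, LX, LY, LX, LZ]), (1, [LX, LX, LY, LY, LZ]), (-1, [LX, LY, LZ, LX, LY]),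
      (-1, [LX, LX, LZ, LY, LY])],
  [(1, [LZ, LX, LZ, LX, LY]), (1, [LX, LX, LZ, LZ, LY]), (-1, [LX, LZ, LY, LX, LZ]),
      (-1, [LX, LX, LY, LZ, LZ])],
  [(1, [LY, LZ, LY, LZ, LX]), (1, [LZ, LZ, LY, LY, LX]), (-1, [LZ, LY, LX, LZ, LY]),
      (-1, [LZ, LZ, LX, LY, LY])],
  [(1, [LX, LX, LY, LY, LZ]), (1, [LX, LX, LZ, LY, LY]), (1, [LX, LY, LX, LY, LZ]),
      (1, [LX, LY, LX, LZ, LY]), (-2, [LX, LX, LY, LZ, LY]), (-2, [LX, LY, LY, LX, LZ])],
  [(1, [LX, LX, LZ, LZ, LY]), (1, [LX, LX, LY, LZ, LZ]), (1, [LX, LZ, LX, LZ, LY]),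
      (1, [LX, LZ, LX, LY, LZ]), (-2, [LX, LX, LZ, LY, LZ]), (-2, [LX, LZ, LZ, LX, LY])],
  [(1, [LY, LY, LZ, LZ, LX]), (1, [LY, LY, LX, LZ, LZ]), (1, [LY, LZ, LY, LZ, LX]),
      (1, [LY, LZ, LY, LX, LZ]), (-2, [LY, LY, LZ, LX, LZ]), (-2, [LY, LZ, LZ, LY, LX])],
  [(1, [LX, LX, LY, LY, LX, LY]), (-1, [LY, LY, LX, LX, LY, LX])],
  [(1, [LX, LX, LZ, LZ, LX, LZ]), (-1, [LZ, LZ, LX, LX, LZ, LX])],
  [(1, [LY, LY, LZ, LZ, LY, LZ]), (-1, [LZ, LZ, LY, LY, LZ, LY])],
  [(1, [LX, LX, LY, LX, LY, LZ]), (1, [LX, LX, LY, LX, LZ, LY]), (1, [LX, LX, LZ, LX, LY, LY]),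
      (-1, [LX, LX, LY, LY, LX, LZ]), (-1, [LX, LX, LY, LZ, LX, LY]),
      (-1, [LX, LX, LZ, LY, LX, LY])],
  [(1, [LY, LY, LX, LY, LX, LZ]), (1, [LY, LY, LX, LY, LZ, LX]), (1, [LY, LY, LZ, LY, LX, LX]),
      (-1, [LY, LY, LX, LX, LY, LZ]), (-1, [LY, LY, LX, LZ, LY, LX]),
      (-1, [LY, LY, LZ, LX, LY, LX])],
  [(1, [LZ, LZ, LY, LZ, LY, LX]), (1, [LZ, LZ, LY, LZ, LX, LY]), (1, [LZ, LZ, LX, LZ, LY, LY]),
      (-1, [LZ, LZ, LY, LY, LZ, LX]), (-1, [LZ, LZ, LY, LX, LZ, LY]),
      (-1, [LZ, LZ, LX, LY, LZ, LY])],
  [(1, [LX, LX, LZ, LX, LZ, LY]), (1, [LX, LX, LZ, LX, LY, LZ]), (1, [LX, LX, LY, LX, LZ, LZ]),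
      (-1, [LX, LX, LZ, LZ, LX, LY]), (-1, [LX, LX, LZ, LY, LX, LZ]),
      (-1, [LX, LX, LY, LZ, LX, LZ])],
  [(1, [LY, LY, LZ, LY, LZ, LX]), (1, [LY, LY, LZ, LY, LX, LZ]), (1, [LY, LY, LX, LY, LZ, LZ]),
      (-1, [LY, LY, LZ, LZ, LY, LX]), (-1, [LY, LY, LZ, LX, LY, LZ]),
      (-1, [LY, LY, LX, LZ, LY, LZ])],
  [(1, [LZ, LZ, LX, LZ, LX, LY]), (1, [LZ, LZ, LX, LZ, LY, LX]), (1, [LZ, LZ, LY, LZ, LX, LX]),
      (-1, [LZ, LZ, LX, LX, LZ, LY]), (-1, [LZ, LZ, LX, LY, LZ, LX]),
      (-1, [LZ, LZ, LY, LX, LZ, LX])],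
  [(1, [LX, LX, LY, LY, LZ, LZ]), (1, [LX, LX, LZ, LY, LZ, LY]), (1, [LX, LY, LX, LZ, LZ, LY]),
      (1, [LX, LY, LZ, LX, LY, LZ]), (1, [LX, LZ, LX, LZ, LY, LY]),
      (-1, [LX, LX, LY, LZ, LY, LZ]), (-1, [LX, LX, LZ, LZ, LY, LY]), (-1, [LX, LY, LX, LY, LZ, LZ]),
      (-1, [LX, LY, LY, LZ, LX, LZ]), (-1, [LX, LZ, LY, LX, LZ, LY])]]"

section \<open>Words in which no letter occurs three times\<close>

context nil_functional
begin

text \<open>The rotation lemmas serve as permutative rewrite rules: ordered rewriting with all
  rotations brings each cyclic word to one representative, so that \<open>linarith\<close>
  recognises equal terms.\<close>

lemma rotations_2:
  shows "F [a, b] = F [b, a]"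
  using cyclic[of "[a]" "[b]"]
  by simp_all

lemma rotations_3:
  shows "F [a, b, c] = F [b, c, a]"
    and "F [a, b, c] = F [c, a, b]"
  using cyclic[of "[a]" "[b, c]"] cyclic[of "[a, b]" "[c]"]
  by simp_all

lemma rotations_4:
  shows "F [a, b, c, d] = F [b, c, d, a]"
    and "F [a, b, c, d] = F [c, d, a, b]"
    and "F [a, b, c, d] = F [d, a, b, c]"
  using cyclic[of "[a]" "[b, c, d]"] cyclic[of "[a, b]" "[c, d]"] cyclic[of "[a, b, c]" "[d]"]
  by simp_all

lemma rotations_5:
  shows "F [a, b, c, d, e] = F [b, c, d, e, a]"
    and "F [a, b, c, d, e] = F [c, d, e, a, b]"
    and "F [a, b, c, d, e] = F [d, e, a, b, c]"
    and "F [a, b, c, d, e] = F [e, a, b, c, d]"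
  using cyclic[of "[a]" "[b, c, d, e]"] cyclic[of "[a, b]" "[c, d, e]"] cyclic[of "[a, b, c]" "[d, e]"]
    cyclic[of "[a, b, c, d]" "[e]"]
  by simp_all

lemma rotations_6:
  shows "F [a, b, c, d, e, f] = F [b, c, d, e, f, a]"
    and "F [a, b, c, d, e, f] = F [c, d, e, f, a, b]"
    and "F [a, b, c, d, e, f] = F [d, e, f, a, b, c]"
    and "F [a, b, c, d, e, f] = F [e, f, a, b, c, d]"
    and "F [a, b, c, d, e, f] = F [f, a, b, c, d, e]"
  using cyclic[of "[a]" "[b, c, d, e, f]"] cyclic[of "[a, b]" "[c, d, e, f]"]
      cyclic[of "[a, b, c]" "[d, e, f]"] cyclic[of "[a, b, c, d]" "[e, f]"]
      cyclic[of "[a, b, c, d, e]" "[f]"]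
  by simp_all

text \<open>The merge gives abab = -2 aabb, so the generator is three times aabb.\<close>

lemma words_aabb:
  assumes n: "n = 4"
    and t: "F [a, a, b, b] - F [a, b, a, b] = 0"
  shows "F [a, a, b, b] = 0 \<and> F [a, b, a, b] = 0"
proof -
  note merges =
    merge_Cons[of "[a]" "[a]" b]
  note eqs = merges[simplified n rotations_4, simplified] t[simplified rotations_4]
  show ?thesis
    using eqs unfolding rotations_4 by (intro conjI; linarith)
qed

text \<open>After merging, the first generator is three times aabc + aacb, and the second is the
  difference of these two words.\<close>

lemma words_aabc:
  assumes n: "n = 4"
    and t: "F [a, a, b, c] + F [a, a, c, b] - 2 * F [a, b, a, c] = 0"
      "F [a, a, b, c] - F [a, a, c, b] = 0"
  shows "F [a, a, b, c] = 0 \<and> F [a, a, c, b] = 0 \<and> F [a, b, a, c] = 0"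
proof -
  note merges =
    merge_Cons[of "[b]" "[c]" a]
  note eqs = merges[simplified n rotations_4, simplified] t[simplified rotations_4]
  show ?thesis
    using eqs unfolding rotations_4 by (intro conjI; linarith)
qed

text \<open>There are six cyclic words with this content; four merges and two generators form a
  nonsingular linear system for them.\<close>

lemma words_aabbc:
  assumes n: "n = 5"
    and t: "F [b, a, b, a, c] + F [a, a, b, b, c] - F [a, b, c, a, b] - F [a, a, c, b, b] = 0"
        "F [a, a, b, b, c] + F [a, a, c, b, b] + F [a, b, a, b, c] + F [a, b, a, c, b]
        - 2 * F [a, a, b, c, b] - 2 * F [a, b, b, a, c] = 0"
  shows "F [a, a, b, b, c] = 0 \<and> F [a, a, b, c, b] = 0 \<and> F [a, a, c, b, b] = 0 \<and>
      F [a, b, a, b, c] = 0 \<and> F [a, b, a, c, b] = 0 \<and> F [a, b, b, a, c] = 0"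
proof -
  note merges =
    merge_Cons[of "[a]" "[a, c]" b]
    merge_Cons[of "[a]" "[c, a]" b]
    merge_Cons[of "[a, a]" "[c]" b]
    merge_Cons[of "[b]" "[b, c]" a]
  note eqs = merges[simplified n rotations_5, simplified] t[simplified rotations_5]
  show ?thesis
    using eqs unfolding rotations_5 by (intro conjI; linarith)
qed

text \<open>Of the sixteen cyclic words with this content, merges express fourteen by p = aabbcc and
  q = aaccbb. One more merge relates p and q, and the generator settles the remaining
  dimension.\<close>

lemma words_aabbcc:
  assumes n: "n = 6"
    and t: "F [a, a, b, b, c, c] + F [a, a, c, b, c, b] + F [a, b, a, c, c, b]
      + F [a, b, c, a, b, c] + F [a, c, a, c, b, b] - F [a, a, b, c, b, c]
      - F [a, a, c, c, b, b] - F [a, b, a, b, c, c] - F [a, b, b, c, a, c]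
      - F [a, c, b, a, c, b] = 0"
  shows "F [a, a, b, b, c, c] = 0 \<and> F [a, a, b, c, b, c] = 0 \<and> F [a, a, b, c, c, b] = 0 \<and>
      F [a, a, c, b, b, c] = 0 \<and> F [a, a, c, b, c, b] = 0 \<and> F [a, a, c, c, b, b] = 0 \<and>
      F [a, b, a, b, c, c] = 0 \<and> F [a, b, a, c, b, c] = 0 \<and> F [a, b, a, c, c, b] = 0 \<and>
      F [a, b, b, a, c, c] = 0 \<and> F [a, b, b, c, a, c] = 0 \<and> F [a, b, c, a, b, c] = 0 \<and>
      F [a, b, c, a, c, b] = 0 \<and> F [a, b, c, b, a, c] = 0 \<and> F [a, c, a, c, b, b] = 0 \<and>
      F [a, c, b, a, c, b] = 0"
proof -
  note merges =
    merge_Cons[of "[a]" "[a, c, c]" b]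
    merge_Cons[of "[a]" "[c, a, c]" b]
    merge_Cons[of "[a]" "[c, c, a]" b]
    merge_Cons[of "[a]" "[a, b, b]" c]
    merge_Cons[of "[a]" "[b, a, b]" c]
    merge_Cons[of "[a, a]" "[c, c]" b]
    merge_Cons[of "[a, a]" "[b, b]" c]
    merge_Cons[of "[a, a, b]" "[b]" c]
    merge_Cons[of "[a, a, c]" "[c]" b]
    merge_Cons[of "[a, b]" "[a, b]" c]
    merge_Cons[of "[a, b]" "[b, a]" c]
    merge_Cons[of "[a, b, a]" "[b]" c]
    merge_Cons[of "[a, c]" "[a, c]" b]
    merge_Cons[of "[a, c]" "[c, a]" b]
    merge_Cons[of "[b]" "[b, c, c]" a]
  note m = merges[simplified n rotations_6, simplified]
  have aabccb: "F [a, a, b, c, c, b] = - F [a, a, b, b, c, c] - F [a, a, c, c, b, b]"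
    using m(6) unfolding rotations_6 by linarith
  have aacbbc: "F [a, a, c, b, b, c] = - F [a, a, b, b, c, c] - F [a, a, c, c, b, b]"
    using m(7) unfolding rotations_6 by linarith
  have aabcbc: "F [a, a, b, c, b, c] = F [a, a, c, c, b, b]"
    using m(8) aabccb unfolding rotations_6 by linarith
  have aacbcb: "F [a, a, c, b, c, b] = F [a, a, b, b, c, c]"
    using m(9) aacbbc unfolding rotations_6 by linarith
  have ababcc: "F [a, b, a, b, c, c] = F [a, a, c, c, b, b]"
    using m(15) aabccb unfolding rotations_6 by linarith
  have abbacc: "F [a, b, b, a, c, c] = - F [a, a, b, b, c, c] - F [a, a, c, c, b, b]"
    using m(3) ababcc unfolding rotations_6 by linarith
  have abbcac: "F [a, b, b, c, a, c] = F [a, a, c, c, b, b]"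
    using m(4) abbacc unfolding rotations_6 by linarith
  have abaccb: "F [a, b, a, c, c, b] = F [a, a, b, b, c, c]"
    using m(1) abbacc unfolding rotations_6 by linarith
  have abcacb: "F [a, b, c, a, c, b] = - F [a, a, b, b, c, c] - F [a, a, c, c, b, b]"
    using m(5) ababcc abaccb unfolding rotations_6 by linarith
  have acacbb: "F [a, c, a, c, b, b] = F [a, a, b, b, c, c]"
    using m(2) abcacb abbcac unfolding rotations_6 by linarith
  have abcabc: "F [a, b, c, a, b, c] = - 2 * F [a, a, c, c, b, b]"
    using m(10) ababcc unfolding rotations_6 by linarith
  have abcbac: "F [a, b, c, b, a, c] = 2 * F [a, a, b, b, c, c] + 2 * F [a, a, c, c, b, b]"
    using m(11) abbacc aabccb unfolding rotations_6 by linarith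
  have abacbc: "F [a, b, a, c, b, c] = - F [a, a, b, b, c, c] - F [a, a, c, c, b, b]"
    using m(12) ababcc abaccb unfolding rotations_6 by linarith
  have acbacb: "F [a, c, b, a, c, b] = - 2 * F [a, a, b, b, c, c]"
    using m(13) acacbb unfolding rotations_6 by linarith
  have sum: "F [a, a, b, b, c, c] + F [a, a, c, c, b, b] = 0"
    using m(14) abbacc aacbbc abacbc unfolding rotations_6 by linarith
  note words = aabccb aacbbc aabcbc aacbcb ababcc abbacc abbcac abaccb abcacb acacbb abcabc abcbac
      abacbc acbacb
  \<comment> \<open>In terms of p and q the generator is 6(p - q).\<close>
  have "F [a, a, b, b, c, c] = 0" "F [a, a, c, c, b, b] = 0"
    using t[simplified rotations_6 words] sum unfolding rotations_6 words by linarith+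
  then show ?thesis
    unfolding words by simp
qed

end

section \<open>Enumeration of cyclic words of length two to six\<close>

definition alphabet :: "letter list" where
  "alphabet = [LX, LY, LZ]"

lemma letter_in_alphabet: "l \<in> set alphabet"
  by (cases l) (auto simp: alphabet_def)

text \<open>All quantifiers range over lists, so \<open>code_simp\<close> can decide the property.
  Words with a tripled letter are left to \<open>count_three\<close>, which requires length at least
  4.\<close>

definition covers :: "nat \<Rightarrow> letter list list \<Rightarrow> bool" where
  "covers n ws \<longleftrightarrow> (\<forall>w \<in> set (List.n_lists n alphabet).
     (\<exists>x \<in> set alphabet. count_list w x \<ge> 3 \<and> n \<ge> 4) \<or> (\<exists>k \<in> set [0..<n]. rotate k w \<in> set ws))"

definition necklaces_2 :: "letter list list" where
  "necklaces_2 =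
    [[LX, LX], [LY, LY], [LZ, LZ], [LX, LY], [LX, LZ], [LY, LZ]]"

lemma covers_2: "covers 2 necklaces_2"
  by code_simp

definition necklaces_3 :: "letter list list" where
  "necklaces_3 =
    [[LX, LX, LX], [LY, LY, LY], [LZ, LZ, LZ], [LX, LX, LY], [LX, LX, LZ],
     [LY, LY, LX], [LY, LY, LZ], [LZ, LZ, LX], [LZ, LZ, LY], [LX, LY, LZ],
     [LX, LZ, LY]]"

lemma covers_3: "covers 3 necklaces_3"
  by code_simp

definition necklaces_4 :: "letter list list" where
  "necklaces_4 =
    [[LX, LX, LY, LY], [LX, LY, LX, LY], [LX, LX, LZ, LZ], [LX, LZ, LX, LZ],
     [LY, LY, LZ, LZ], [LY, LZ, LY, LZ], [LX, LX, LY, LZ], [LX, LX, LZ, LY],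
     [LX, LY, LX, LZ], [LY, LY, LX, LZ], [LY, LY, LZ, LX], [LY, LX, LY, LZ],
     [LZ, LZ, LX, LY], [LZ, LZ, LY, LX], [LZ, LX, LZ, LY]]"

lemma covers_4: "covers 4 necklaces_4"
  by code_simp

definition necklaces_5 :: "letter list list" where
  "necklaces_5 =
    [[LX, LX, LY, LY, LZ], [LX, LX, LY, LZ, LY], [LX, LX, LZ, LY, LY],
     [LX, LY, LX, LY, LZ], [LX, LY, LX, LZ, LY], [LX, LY, LY, LX, LZ],
     [LX, LX, LZ, LZ, LY], [LX, LX, LZ, LY, LZ], [LX, LX, LY, LZ, LZ],
     [LX, LZ, LX, LZ, LY], [LX, LZ, LX, LY, LZ], [LX, LZ, LZ, LX, LY],
     [LZ, LZ, LY, LY, LX], [LZ, LZ, LY, LX, LY], [LZ, LZ, LX, LY, LY],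
     [LZ, LY, LZ, LY, LX], [LZ, LY, LZ, LX, LY], [LZ, LY, LY, LZ, LX]]"

lemma covers_5: "covers 5 necklaces_5"
  by code_simp

definition necklaces_6 :: "letter list list" where
  "necklaces_6 =
    [[LX, LX, LY, LY, LZ, LZ], [LX, LX, LY, LZ, LY, LZ], [LX, LX, LY, LZ, LZ, LY],
     [LX, LX, LZ, LY, LY, LZ], [LX, LX, LZ, LY, LZ, LY], [LX, LX, LZ, LZ, LY, LY],
     [LX, LY, LX, LY, LZ, LZ], [LX, LY, LX, LZ, LY, LZ], [LX, LY, LX, LZ, LZ, LY],
     [LX, LY, LY, LX, LZ, LZ], [LX, LY, LY, LZ, LX, LZ], [LX, LY, LZ, LX, LY, LZ],
     [LX, LY, LZ, LX, LZ, LY], [LX, LY, LZ, LY, LX, LZ], [LX, LZ, LX, LZ, LY, LY],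
     [LX, LZ, LY, LX, LZ, LY]]"

lemma covers_6: "covers 6 necklaces_6"
  by code_simp

lemma covers_imp_zero:
  fixes w :: "letter list" and G :: "letter list \<Rightarrow> real"
  assumes "covers n ws" "length w = n" "\<And>v. v \<in> set ws \<Longrightarrow> G v = 0"
    and "\<And>x. n \<ge> 4 \<Longrightarrow> count_list w x \<ge> 3 \<Longrightarrow> G w = 0" "\<And>k. G (rotate k w) = G w"
  shows "G w = 0"
proof -
  have "w \<in> set (List.n_lists n alphabet)"
    using assms(2) letter_in_alphabet by (auto simp: set_n_lists)
  with assms(1) show ?thesis
    unfolding covers_def using assms(3-5) by metis
qed

text \<open>Adds what is specific to the matrices x, y, z and the subalgebra: \<open>single\<close>
  expresses tracelessness, \<open>generator\<close> that the generators of length \<open>n\<close>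
  lie in the subalgebra on which the functional vanishes.\<close>

locale trace_functional = nil_functional F n for F :: "letter list \<Rightarrow> real" and n +
  assumes single: "F [l] = 0"
    and generator: "\<lbrakk>L \<in> set t_rows; \<forall>(c, w) \<in> set L. length w = n\<rbrakk> \<Longrightarrow>
      (\<Sum>(c, w)\<leftarrow>L. of_int c * F w) = 0"
begin

lemma generators: "\<forall>L \<in> set t_rows. (\<forall>(c, w) \<in> set L. length w = n) \<longrightarrow>
    (\<Sum>(c, w)\<leftarrow>L. of_int c * F w) = 0"
  using generator by blast

lemma degree_2:
  assumes n: "n = 2" and "v \<in> set necklaces_2"
  shows "F v = 0"
  using generators assms(2) unfolding n by (auto simp: t_rows_def necklaces_2_def rotations_2)

lemma degree_3:
  assumes n: "n = 3" and "v \<in> set necklaces_3"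
  shows "F v = 0"
  using generators assms(2) unfolding n by (auto simp: t_rows_def necklaces_3_def rotations_3)

lemma degree_4:
  assumes n: "n = 4"
  shows "\<forall>v \<in> set necklaces_4. F v = 0"
proof -
  note t = generators[unfolded n, simplified t_rows_def, simplified, simplified rotations_4]
  have e0: "F [LX, LX, LY, LY] = 0 \<and> F [LX, LY, LX, LY] = 0"
    by (rule words_aabb[OF n]; use t in \<open>(simp only: rotations_4)?; linarith\<close>)
  have e1: "F [LX, LX, LZ, LZ] = 0 \<and> F [LX, LZ, LX, LZ] = 0"
    by (rule words_aabb[OF n]; use t in \<open>(simp only: rotations_4)?; linarith\<close>)
  have e2: "F [LY, LY, LZ, LZ] = 0 \<and> F [LY, LZ, LY, LZ] = 0"
    by (rule words_aabb[OF n]; use t in \<open>(simp only: rotations_4)?; linarith\<close>)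
  have e3: "F [LX, LX, LY, LZ] = 0 \<and> F [LX, LX, LZ, LY] = 0 \<and> F [LX, LY, LX, LZ] = 0"
    by (rule words_aabc[OF n]; use t in \<open>(simp only: rotations_4)?; linarith\<close>)
  have e4: "F [LY, LY, LX, LZ] = 0 \<and> F [LY, LY, LZ, LX] = 0 \<and> F [LY, LX, LY, LZ] = 0"
    by (rule words_aabc[OF n]; use t in \<open>(simp only: rotations_4)?; linarith\<close>)
  have e5: "F [LZ, LZ, LX, LY] = 0 \<and> F [LZ, LZ, LY, LX] = 0 \<and> F [LZ, LX, LZ, LY] = 0"
    by (rule words_aabc[OF n]; use t in \<open>(simp only: rotations_4)?; linarith\<close>)
  show ?thesis
    using e0 e1 e2 e3 e4 e5 by (simp add: necklaces_4_def)
qed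

lemma degree_5:
  assumes n: "n = 5"
  shows "\<forall>v \<in> set necklaces_5. F v = 0"
proof -
  note t = generators[unfolded n, simplified t_rows_def, simplified, simplified rotations_5]
  have e0: "F [LX, LX, LY, LY, LZ] = 0 \<and> F [LX, LX, LY, LZ, LY] = 0 \<and> F [LX, LX, LZ, LY, LY] = 0 \<and>
      F [LX, LY, LX, LY, LZ] = 0 \<and> F [LX, LY, LX, LZ, LY] = 0 \<and> F [LX, LY, LY, LX, LZ] = 0"
    by (rule words_aabbc[OF n]; use t in \<open>(simp only: rotations_5)?; linarith\<close>)
  have e1: "F [LX, LX, LZ, LZ, LY] = 0 \<and> F [LX, LX, LZ, LY, LZ] = 0 \<and> F [LX, LX, LY, LZ, LZ] = 0 \<and>
      F [LX, LZ, LX, LZ, LY] = 0 \<and> F [LX, LZ, LX, LY, LZ] = 0 \<and> F [LX, LZ, LZ, LX, LY] = 0"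
    by (rule words_aabbc[OF n]; use t in \<open>(simp only: rotations_5)?; linarith\<close>)
  have e2: "F [LZ, LZ, LY, LY, LX] = 0 \<and> F [LZ, LZ, LY, LX, LY] = 0 \<and> F [LZ, LZ, LX, LY, LY] = 0 \<and>
      F [LZ, LY, LZ, LY, LX] = 0 \<and> F [LZ, LY, LZ, LX, LY] = 0 \<and> F [LZ, LY, LY, LZ, LX] = 0"
    by (rule words_aabbc[OF n]; use t in \<open>(simp only: rotations_5)?; linarith\<close>)
  show ?thesis
    using e0 e1 e2 by (simp add: necklaces_5_def)
qed

lemma degree_6:
  assumes n: "n = 6"
  shows "\<forall>v \<in> set necklaces_6. F v = 0"
proof -
  note t = generators[unfolded n, simplified t_rows_def, simplified, simplified rotations_6]
  have e0: "F [LX, LX, LY, LY, LZ, LZ] = 0 \<and> F [LX, LX, LY, LZ, LY, LZ] = 0 \<and>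
      F [LX, LX, LY, LZ, LZ, LY] = 0 \<and> F [LX, LX, LZ, LY, LY, LZ] = 0 \<and>
      F [LX, LX, LZ, LY, LZ, LY] = 0 \<and> F [LX, LX, LZ, LZ, LY, LY] = 0 \<and>
      F [LX, LY, LX, LY, LZ, LZ] = 0 \<and> F [LX, LY, LX, LZ, LY, LZ] = 0 \<and>
      F [LX, LY, LX, LZ, LZ, LY] = 0 \<and> F [LX, LY, LY, LX, LZ, LZ] = 0 \<and>
      F [LX, LY, LY, LZ, LX, LZ] = 0 \<and> F [LX, LY, LZ, LX, LY, LZ] = 0 \<and>
      F [LX, LY, LZ, LX, LZ, LY] = 0 \<and> F [LX, LY, LZ, LY, LX, LZ] = 0 \<and>
      F [LX, LZ, LX, LZ, LY, LY] = 0 \<and> F [LX, LZ, LY, LX, LZ, LY] = 0"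
    by (rule words_aabbcc[OF n]; use t in \<open>(simp only: rotations_6)?; linarith\<close>)
  show ?thesis
    using e0 by (simp add: necklaces_6_def)
qed

lemma sandwich_first: "length v + 4 = n \<Longrightarrow> F (x # x # [x] @ x # v) = 0"
  using cube_Cons[of "x # v" x] by simp

lemma sandwich_degree_5:
  assumes n: "n = 5"
  shows "F [x, x, p, x, q] = 0"
proof -
  note t = generators[unfolded n, simplified t_rows_def, simplified]
  have "F [LX, LX, LY, LX, LZ] = 0 \<and> F [LX, LX, LZ, LX, LY] = 0"
    "F [LY, LY, LX, LY, LZ] = 0 \<and> F [LY, LY, LZ, LY, LX] = 0"
    "F [LZ, LZ, LY, LZ, LX] = 0 \<and> F [LZ, LZ, LX, LZ, LY] = 0"
    by (rule sandwich_five[OF n]; use t in linarith)+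
  \<comment> \<open>When the letters are not distinct, a cube, two squares or antisymmetry suffice;
    the generators handle three distinct letters.\<close>
  moreover have "F [x, x, p, x, q] = 0" if "p = x \<or> q = x \<or> p = q"
    using that sandwich_self[of "[p]" x] sandwich_first[of "[q]" x] square_square[of "[p]" "[]" x] n
    by auto
  ultimately show ?thesis
    by (cases x; cases p; cases q) auto
qed

lemma sandwich_degree_6:
  assumes n: "n = 6"
  shows "F [x, x, p, x, q, r] = 0"
proof -
  note t = generators[unfolded n, simplified t_rows_def, simplified]
  have bbb: "F [LX, LX, LY, LX, LY, LY] = 0 \<and> F [LY, LY, LX, LY, LX, LX] = 0"
    "F [LX, LX, LZ, LX, LZ, LZ] = 0 \<and> F [LZ, LZ, LX, LZ, LX, LX] = 0"
    "F [LY, LY, LZ, LY, LZ, LZ] = 0 \<and> F [LZ, LZ, LY, LZ, LY, LY] = 0"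
    by (rule sandwich_bbb[OF n]; use t in linarith)+
  have bbc: "F [a, a, b, a, b, c] = 0 \<and> F [a, a, b, a, c, b] = 0 \<and> F [a, a, c, a, b, b] = 0"
    if "(a, b, c) \<in> {(LX, LY, LZ), (LY, LX, LZ), (LZ, LY, LX), (LX, LZ, LY), (LY, LZ, LX),
        (LZ, LX, LY)}"
    for a b c
    by (rule sandwich_bbc[OF n]; use that t in \<open>elim insertE emptyE; simp\<close>)
  \<comment> \<open>A fourth \<open>x\<close> gives a cube if \<open>p = x\<close> and two squares
    if \<open>q = x\<close>; for \<open>r = x\<close> antisymmetry first brings two letters
    \<open>x\<close> together.\<close>
  have one: "F [x, x, p, x, q, r] = 0" if "p = x \<or> q = x \<or> r = x"
    using that sandwich_first[of "[q, r]" x] square_square[of "[p]" "[r]" x]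
      square_square[of "[p]" "[r]" x] cube_Cons[of "[p, x, q]" x] n
      square_square[of "[p]" "[q]" x]
      sandwich_antisym[of "[p]" "[q, x]" x] square_square[of "[q]" "[p]" x]
    by auto
  show ?thesis
    using bbb bbc[of x p q] bbc[of x p r] bbc[of x q p] one
    by (cases x; cases p; cases q; cases r) auto
qed

text \<open>Nonempty \<open>u\<close> and \<open>v\<close> force length at least 5. Lengths 5 and 6
  use the generators; from 7 on the nil identity alone suffices.\<close>

lemma sandwich_zero:
  assumes "n \<ge> 4" "u \<noteq> []" "v \<noteq> []" "length u + length v + 3 = n"
  shows "F (x # x # u @ x # v) = 0"
proof -
  have pos: "length u > 0" "length v > 0" using assms by auto
  consider "n = 5" "length u = 1" "length v = 1" | "n = 6" "length u = 1" "length v = 2"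
    | "n = 6" "length u = 2" "length v = 1" | "n \<ge> 7"
    using assms(4) pos by linarith
  then show ?thesis
  proof cases
    case 1
    then show ?thesis using sandwich_degree_5 by (auto simp: length_Suc_conv)
  next
    case 2
    then show ?thesis using sandwich_degree_6 by (auto simp: length_Suc_conv numeral_2_eq_2)
  next
    case 3
    then have "F (x # x # v @ x # u) = 0"
      using sandwich_degree_6 by (auto simp: length_Suc_conv numeral_2_eq_2)
    then show ?thesis using sandwich_antisym[of u v x] assms by simp
  next
    case 4
    then show ?thesis using sandwich_long assms by blast
  qed
qed

lemma length_eq_counts: "length w = count_list w LX + count_list w LY + count_list w LZ"
  by (induction w) (auto split: letter.splits, metis letter.exhaust)

theorem words_zero:
  assumes "length w = n" "w \<noteq> []"
  shows "F w = 0"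
proof -
  have three: "F w = 0" if "n \<ge> 4" "count_list w x \<ge> 3" for x
    using count_three[OF that(1) assms(1) that(2)] sandwich_zero that(1) by blast
  have cov: "F w = 0" if "covers n ws" "\<And>v. v \<in> set ws \<Longrightarrow> F v = 0" for ws
    by (rule covers_imp_zero[OF that(1) assms(1) that(2) three rotate_eq])
  have "length w > 0" using assms(2) by simp
  then consider "n = 1" | "n = 2" | "n = 3" | "n = 4" | "n = 5" | "n = 6" | "n \<ge> 7"
    using assms(1) by linarith
  then show ?thesis
  proof cases
    case 1
    then show ?thesis using single assms by (auto simp: length_Suc_conv)
  next
    case 2
    then show ?thesis using cov covers_2 degree_2 by blast
  next
    case 3
    then show ?thesis using cov covers_3 degree_3 by blast
  next
    case 4
    then show ?thesis using cov covers_4 degree_4 by blast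
  next
    case 5
    then show ?thesis using cov covers_5 degree_5 by blast
  next
    case 6
    then show ?thesis using cov covers_6 degree_6 by blast
  next
    case 7
    \<comment> \<open>Pigeonhole: seven positions, three letters.\<close>
    then consider "count_list w LX \<ge> 3" | "count_list w LY \<ge> 3" | "count_list w LZ \<ge> 3"
      using length_eq_counts[of w] assms(1) by linarith
    then show ?thesis using three 7 by cases auto
  qed
qed

end

section \<open>Trace identities for 3 by 3 matrices\<close>

lemma Const_arith:
  "Const 0 = 0" "Const 1 = 1" "Const (a + b) = Const a + Const b"
      "Const (a * b) = Const a * Const b"
  "Const (- a) = - Const a" "Const (of_int k) = of_int k" "Const (of_nat m) = of_nat m"
  "Const (numeral j) = numeral j"
  by (simp_all add: Const_def single_add mult_single single_uminus)

definition word_mat :: "('l \<Rightarrow> 'a::comm_ring_1^3^3) \<Rightarrow> 'l list \<Rightarrow> 'a^3^3" where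
  "word_mat M w = foldr (**) (map M w) (mat 1)"

lemma word_mat_simps [simp]: "word_mat M [] = mat 1" "word_mat M (l # w) = M l ** word_mat M w"
  by (simp_all add: word_mat_def)

lemma word_mat_append: "word_mat M (u @ v) = word_mat M u ** word_mat M v"
  by (induction u) (simp_all add: matrix_mul_assoc)

lemma tr_map: "tr (map M w) = trace (word_mat M w)"
  by (simp add: tr_def word_mat_def)

lemma matrix_add_rdistrib: "(A + B) ** C = A ** C + B ** (C :: 'a::comm_ring_1^3^3)"
  by (simp add: matrix_matrix_mult_def vec_eq_iff sum.distrib distrib_right)

lemma trace_scale: "trace (mat c ** A) = c * trace (A :: 'a::comm_ring_1^3^3)"
  by (simp add: trace_def matrix_matrix_mult_def mat_def sum_3 algebra_simps)

lemma scale_commute: "mat c ** A = A ** mat c" for A :: "'a::comm_ring_1^3^3"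
  by (simp add: vec_eq_iff forall_3 matrix_matrix_mult_def mat_def sum_3 mult.commute)

text \<open>The full linearisation of the cubic Cayley-Hamilton equation. Entrywise it is a
  polynomial identity with integer coefficients, checked by expansion over any commutative
  ring.\<close>

lemma polarised_Cayley_Hamilton:
  fixes A B C :: "'a::comm_ring_1^3^3"
  defines "t P \<equiv> mat (trace P)"
  shows "A ** B ** C + A ** C ** B + B ** A ** C + B ** C ** A + C ** A ** B + C ** B ** A =
    t A ** (B ** C) + t A ** (C ** B) + t B ** (A ** C) + t B ** (C ** A) + t C ** (A ** B)
    + t C ** (B ** A)
    + mat (trace (B ** C) - trace B * trace C) ** A + mat (trace (A ** C) - trace A * trace C) ** B
    + mat (trace (A ** B) - trace A * trace B) ** C
    + mat (trace A * trace B * trace C - trace A * trace (B ** C) - trace B * trace (A ** C)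
        - trace C * trace (A ** B) + trace (A ** B ** C) + trace (A ** C ** B))"
  unfolding t_def vec_eq_iff forall_3
  by (intro conjI; simp add: trace_def matrix_matrix_mult_def mat_def sum_3 algebra_simps)

text \<open>Multiply the polarised identity by D and take traces. The right side consists of
  products of at least two traces.\<close>

lemma fundamental_trace_identity:
  fixes A B C D :: "'a::comm_ring_1^3^3"
  shows "trace (A ** B ** C ** D) + trace (A ** C ** B ** D) + trace (B ** A ** C ** D)
      + trace (B ** C ** A ** D) + trace (C ** A ** B ** D) + trace (C ** B ** A ** D) =
    trace A * (trace (B ** C ** D) + trace (C ** B ** D))
    + trace B * (trace (A ** C ** D) + trace (C ** A ** D))
    + trace C * (trace (A ** B ** D) + trace (B ** A ** D))
    + (trace (B ** C) - trace B * trace C) * trace (A ** D)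
    + (trace (A ** C) - trace A * trace C) * trace (B ** D)
    + (trace (A ** B) - trace A * trace B) * trace (C ** D)
    + (trace A * trace B * trace C - trace A * trace (B ** C) - trace B * trace (A ** C)
        - trace C * trace (A ** B) + trace (A ** B ** C) + trace (A ** C ** B)) * trace D"
proof -
  have assoc: "mat c ** P ** D = mat c ** (P ** D)" for c and P :: "'a^3^3"
    by (simp add: matrix_mul_assoc)
  show ?thesis
    using arg_cong[OF polarised_Cayley_Hamilton[of A B C], of "\<lambda>P. trace (P ** D)"]
    by (simp only: matrix_add_rdistrib trace_add assoc trace_scale) (simp add: algebra_simps)
qed


section \<open>Subalgebras and separating functionals\<close>

locale scalar_subalgebra =
  fixes B :: "mpoly set"
  assumes subalgebra: "subalgebra B"
begin

lemma Const_mem: "Const c \<in> B"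
  and add_mem: "p \<in> B \<Longrightarrow> q \<in> B \<Longrightarrow> p + q \<in> B"
  and mult_mem: "p \<in> B \<Longrightarrow> q \<in> B \<Longrightarrow> p * q \<in> B"
  using subalgebra by (auto simp: subalgebra_def)

lemma zero_mem: "0 \<in> B" and one_mem: "1 \<in> B" and numeral_mem: "numeral k \<in> B" and
    of_int_mem: "of_int i \<in> B"
  using Const_mem[of 0] Const_mem[of 1] Const_mem[of "numeral k"] Const_mem[of "of_int i"]
  by (simp_all add: Const_arith)

lemma uminus_mem: "p \<in> B \<Longrightarrow> - p \<in> B"
  using mult_mem[of "Const (- 1)" p] Const_mem[of "- 1"] by (metis Const_arith(2,5) mult_minus1)

lemma diff_mem: "p \<in> B \<Longrightarrow> q \<in> B \<Longrightarrow> p - q \<in> B"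
  using add_mem[of p "- q"] uminus_mem by simp

lemma sum_list_mem: "(\<And>x. x \<in> set xs \<Longrightarrow> f x \<in> B) \<Longrightarrow> (\<Sum>x\<leftarrow>xs. f x) \<in> B"
  by (induction xs) (auto intro: zero_mem add_mem)

lemmas mem_intros = Const_mem add_mem mult_mem zero_mem one_mem numeral_mem of_int_mem uminus_mem
    diff_mem

text \<open>Passes between generic and traceless generic matrices, in either direction, since these
  differ by scalar matrices.\<close>

lemma trace_shift_mem:
  assumes traces: "\<And>w. trace (word_mat M w) \<in> B"
    and shift: "\<And>l. N l = M l + mat (c l)" "\<And>l. c l \<in> B"
  shows "trace (word_mat N w) \<in> B"
proof -
  \<comment> \<open>Mixed words make the induction work: the last letter of the \<open>N\<close>
    part moves into the \<open>M\<close> part, and the scalar correction commutes out.\<close>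
  have "trace (word_mat N w ** word_mat M u) \<in> B" for u
  proof (induction w arbitrary: u rule: rev_induct)
    case Nil
    then show ?case using traces by simp
  next
    case (snoc l w)
    have "word_mat N (w @ [l]) ** word_mat M u = word_mat N w ** word_mat M (l # u) + mat (c l) **
        (word_mat N w ** word_mat M u)"
      using scale_commute[of "c l" "word_mat N w"]
      by (simp add: word_mat_append shift(1) matrix_add_ldistrib matrix_add_rdistrib
          matrix_mul_assoc)
    then show ?case
      by (simp add: trace_add trace_scale del: word_mat_simps) (intro mem_intros snoc shift(2))
  qed
  from this[of "[]"] show ?thesis by simp
qed

text \<open>As \<open>B\<close> is a real subspace, \<open>p\<close> extends a basis of it to an
  independent set, on which a linear map can be prescribed. Scalars are restricted to the reals
  because \<open>linarith\<close> is to work with the values.\<close>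

lemma exists_functional:
  assumes "p \<notin> B"
  obtains f :: "mpoly \<Rightarrow> real" where "\<And>q r. f (q + r) = f q + f r" "\<And>q. q \<in> B \<Longrightarrow> f q = 0" "f p \<noteq> 0"
proof -
  define scale where "scale r q = Const (of_real r) * q" for r :: real and q :: mpoly
  interpret vector_space_pair scale "(*) :: real \<Rightarrow> real \<Rightarrow> real"
    by unfold_locales (simp_all add: scale_def Const_arith algebra_simps)
  have sub: "vs1.subspace B"
    unfolding vs1.subspace_def by (auto simp: scale_def intro: mem_intros)
  obtain E where E: "E \<subseteq> B" "vs1.independent E" "B \<subseteq> vs1.span E"
    by (rule vs1.maximal_independent_subset)
  have span: "vs1.span E = B"
    using E sub vs1.span_minimal by blast
  then have "vs1.independent (insert p E)"
    using E(2) assms by (simp add: vs1.independent_insert)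
  from linear_independent_extend[OF this, of "\<lambda>q. if q = p then 1 else 0"]
  obtain f where f: "Vector_Spaces.linear scale (*) f"
      "\<forall>q\<in>insert p E. f q = (if q = p then 1 else 0)"
    by blast
  interpret f: Vector_Spaces.linear scale "(*)" f by (rule f(1))
  have "f q = 0" if "q \<in> B" for q
    by (rule f.eq_0_on_span[of E]) (use that span f(2) E(1) assms in auto)
  then show ?thesis
    using that[of f] f.add f(2) by auto
qed

end

section \<open>Generation\<close>

definition generic0 :: "letter \<Rightarrow> mpoly^3^3" where
  "generic0 l = traceless (generic l)"

text \<open>Ties the integer encoding \<open>t_rows\<close>, on which all computations run, to the
  given list of generators.\<close>

lemma t_list_eq:
  "t_list = [tr [generic LX], tr [generic LY], tr [generic LZ]] @
     map (\<lambda>L. \<Sum>(c, w)\<leftarrow>L. of_int c * trace (word_mat generic0 w)) t_rows"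
  unfolding t_list_def Let_def t_rows_def
  by (simp add: tr_map[of generic0, symmetric] generic0_def del: word_mat_simps)

lemma generic0_shift:
  "generic0 l = generic l + mat (- (Const (1/3) * trace (generic l)))"
  "generic l = generic0 l + mat (Const (1/3) * trace (generic l))"
  by (simp_all add: generic0_def traceless_def vec_eq_iff mat_def)

lemma three_thirds: "Const (1/3) * 3 = 1"
  using Const_arith(4)[of "1/3" 3] by (simp add: Const_arith)

lemma trace_generic0: "trace (generic0 l) = 0"
proof -
  have "trace (mat c :: mpoly^3^3) = 3 * c" for c
    by (simp add: trace_def mat_def sum_3)
  then have "trace (generic0 l) = trace (generic l) - (Const (1/3) * 3) * trace (generic l)"
    by (simp add: generic0_def traceless_def trace_sub)
  then show ?thesis by (simp add: three_thirds)
qed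

lemma trace_one: "trace (mat 1 :: 'a::comm_ring_1^3^3) = 3"
  by (simp add: trace_def mat_def sum_3)

lemma subalgebra_hull: "subalgebra (subalgebra hull S)"
  by (rule hull_in) (auto simp: subalgebra_def)

lemma additive_sum_list:
  fixes f :: "mpoly \<Rightarrow> real"
  assumes add: "\<And>q r. f (q + r) = f q + f r"
  shows "f (\<Sum>(c, w)\<leftarrow>L. of_int c * g w) = (\<Sum>(c, w)\<leftarrow>L. of_int c * f (g w))"
proof -
  interpret additive f by unfold_locales (rule add)
  have nat: "f (of_nat k * q) = of_nat k * f q" for k q
    by (induction k) (simp_all add: zero algebra_simps add)
  have "f (of_int c * q) = of_int c * f q" for c q
    by (cases c rule: int_cases2) (simp_all add: nat minus)
  then show ?thesis
    by (induction L) (auto simp: zero add)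
qed

context scalar_subalgebra
begin

lemma trace_words_mem:
  assumes t: "set t_list \<subseteq> B"
  shows "trace (word_mat generic0 w) \<in> B"
proof (induction "length w" arbitrary: w rule: less_induct)
  case less
  show ?case
  proof (rule ccontr)
    assume notin: "trace (word_mat generic0 w) \<notin> B"
    have "w \<noteq> []"
    proof
      assume "w = []"
      with notin numeral_mem[of "num.Bit1 num.One"] show False by (simp add: trace_one)
    qed
    obtain f :: "mpoly \<Rightarrow> real" where add: "\<And>q r. f (q + r) = f q + f r"
      and zero: "\<And>q. q \<in> B \<Longrightarrow> f q = 0" and nz: "f (trace (word_mat generic0 w)) \<noteq> 0"
      using exists_functional[OF notin] by blast
    have short: "trace (word_mat generic0 v) \<in> B" if "length v < length w" for v
      using less that by blast
    interpret trace_functional "\<lambda>v. f (trace (word_mat generic0 v))" "length w"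
    proof
      show "f (trace (word_mat generic0 (u @ v))) = f (trace (word_mat generic0 (v @ u)))" for u v
        unfolding word_mat_append by (rule arg_cong[OF trace_mul_sym])
      show "f (trace (word_mat generic0 [l])) = 0" for l
        using zero[OF zero_mem] by (simp add: trace_generic0)
      show "(\<Sum>(c, v)\<leftarrow>L. of_int c * f (trace (word_mat generic0 v))) = 0" if "L \<in> set t_rows" for L
      proof -
        have "(\<Sum>(c, v)\<leftarrow>L. of_int c * trace (word_mat generic0 v)) \<in> B"
          using that t unfolding t_list_eq by auto
        from zero[OF this] show ?thesis
          using additive_sum_list[of f "\<lambda>v. trace (word_mat generic0 v)", OF add] by simp
      qed
      fix a b c d :: "letter list"
      assume ne: "a \<noteq> []" "b \<noteq> []" "c \<noteq> []" "d \<noteq> []" and len: "length (a @ b @ c @ d) = length w"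
      have pos: "length a > 0" "length b > 0" "length c > 0" "length d > 0" using ne by auto
      let ?t = "\<lambda>v. trace (word_mat generic0 v)"
      note fti = fundamental_trace_identity[of "word_mat generic0 a" "word_mat generic0 b"
          "word_mat generic0 c" "word_mat generic0 d",
          folded word_mat_append, unfolded append_assoc]
      \<comment> \<open>Each trace on the right side of the identity belongs to a word shorter than
        \<open>w\<close>, so it lies in \<open>B\<close> by induction.\<close>
      have "?t (a @ b @ c @ d) + ?t (a @ c @ b @ d) + ?t (b @ a @ c @ d) + ?t (b @ c @ a @ d)
          + ?t (c @ a @ b @ d) + ?t (c @ b @ a @ d) \<in> B"
        unfolding fti
        by (intro mem_intros short;
            use pos len[unfolded length_append] in \<open>(simp only: length_append)?; linarith\<close>)
      from zero[OF this]
      show "f (?t (a @ b @ c @ d)) + f (?t (a @ c @ b @ d)) + f (?t (b @ a @ c @ d))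
          + f (?t (b @ c @ a @ d)) + f (?t (c @ a @ b @ d)) + f (?t (c @ b @ a @ d)) = 0"
        by (simp only: add)
    qed
    show False
      using words_zero[of w] \<open>w \<noteq> []\<close> nz by simp
  qed
qed

lemma trace_generic_mem:
  assumes t: "set t_list \<subseteq> B"
  shows "trace (word_mat generic w) \<in> B"
proof (rule trace_shift_mem[OF trace_words_mem[OF t] generic0_shift(2)])
  have "trace (generic l) \<in> B" for l
    using t unfolding t_list_eq by (cases l) (simp_all add: tr_def)
  then show "Const (1/3) * trace (generic l) \<in> B" for l
    by (intro mem_intros)
qed

lemma t_list_mem:
  assumes "\<And>w. w \<noteq> [] \<Longrightarrow> tr (map generic w) \<in> B"
  shows "set t_list \<subseteq> B"
proof -
  have gen: "trace (word_mat generic w) \<in> B" for w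
  proof (cases "w = []")
    case True
    then show ?thesis using numeral_mem[of "num.Bit1 num.One"] by (simp add: trace_one)
  qed (use assms in \<open>simp add: tr_map\<close>)
  have "- (Const (1/3) * trace (generic l)) \<in> B" for l
    using gen[of "[l]"] by (intro mem_intros) simp
  from trace_shift_mem[OF gen generic0_shift(1) this]
  have "(\<Sum>(c, w)\<leftarrow>L. of_int c * trace (word_mat generic0 w)) \<in> B" for L
    by (intro sum_list_mem) (auto intro!: mult_mem of_int_mem)
  then show ?thesis
    using assms[of "[LX]"] assms[of "[LY]"] assms[of "[LZ]"] unfolding t_list_eq by auto
qed

end

theorem hull_t_list: "subalgebra hull (set t_list) = C33"
proof
  interpret C: scalar_subalgebra C33
    by unfold_locales (simp add: C33_def subalgebra_hull)
  interpret H: scalar_subalgebra "subalgebra hull set t_list"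
    by unfold_locales (rule subalgebra_hull)
  have "tr (map generic w) \<in> C33" if "w \<noteq> []" for w
    unfolding C33_def by (rule hull_inc) (use that in blast)
  then show "subalgebra hull set t_list \<subseteq> C33"
    by (intro hull_minimal C.t_list_mem C.subalgebra)
  show "C33 \<subseteq> subalgebra hull set t_list"
    unfolding C33_def
    by (intro hull_minimal subalgebra_hull) (auto simp: tr_map intro!: H.trace_generic_mem
        hull_subset)
qed

section \<open>Homogeneity\<close>

instance letter :: finite
proof
  have "UNIV = {LX, LY, LZ}" using letter.exhaust by auto
  then show "finite (UNIV :: letter set)" by (metis finite.emptyI finite.insertI)
qed

definition homogeneous_of :: "nat \<Rightarrow> mpoly \<Rightarrow> bool" where
  "homogeneous_of d p \<longleftrightarrow> (\<forall>m \<in> Poly_Mapping.keys p. monomial_degree m = d)"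

lemma monomial_degree_UNIV: "monomial_degree m = (\<Sum>v\<in>UNIV. Poly_Mapping.lookup m v)"
  unfolding monomial_degree_def by (rule sum.mono_neutral_left) (auto simp: in_keys_iff)

lemma monomial_degree_add: "monomial_degree (m + m') = monomial_degree m + monomial_degree m'"
  by (simp add: monomial_degree_UNIV lookup_add sum.distrib)

lemma homogeneous_of_add: "homogeneous_of d p \<Longrightarrow> homogeneous_of d q \<Longrightarrow> homogeneous_of d (p + q)"
  unfolding homogeneous_of_def using Poly_Mapping.keys_add[of p q] by blast

lemma homogeneous_of_mult:
  "homogeneous_of d p \<Longrightarrow> homogeneous_of e q \<Longrightarrow> homogeneous_of (d + e) (p * q)"
  unfolding homogeneous_of_def using keys_mult[of p q] by (auto simp: monomial_degree_add)

lemma homogeneous_of_zero: "homogeneous_of d 0"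
  by (simp add: homogeneous_of_def)

lemma homogeneous_of_Const: "homogeneous_of 0 (Const c)"
  by (simp add: homogeneous_of_def Const_def monomial_degree_def)

lemma homogeneous_of_of_int: "homogeneous_of 0 (of_int k)"
  using homogeneous_of_Const[of "of_int k"] by (simp add: Const_arith)

lemma homogeneous_of_scale: "homogeneous_of 0 c \<Longrightarrow> homogeneous_of d p \<Longrightarrow> homogeneous_of d (c * p)"
  using homogeneous_of_mult[of 0 c d p] by simp

lemma homogeneous_of_sum: "(\<And>i. i \<in> I \<Longrightarrow> homogeneous_of d (f i)) \<Longrightarrow> homogeneous_of d (sum f I)"
  by (induction I rule: infinite_finite_induct) (auto intro: homogeneous_of_add homogeneous_of_zero)

lemma homogeneous_of_word_mat:
  assumes "\<And>l i j. homogeneous_of 1 (M l $ i $ j)"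
  shows "homogeneous_of (length w) (word_mat M w $ i $ j)"
proof (induction w arbitrary: i j)
  case Nil
  then show ?case
    using homogeneous_of_Const[of 1] by (simp add: mat_def homogeneous_of_zero Const_arith)
next
  case (Cons l w)
  then show ?case
    using homogeneous_of_mult[OF assms Cons.IH]
    by (simp add: matrix_matrix_mult_def homogeneous_of_sum)
qed

lemma homogeneous_of_trace: "(\<And>i j. homogeneous_of d (A $ i $ j)) \<Longrightarrow> homogeneous_of d (trace A)"
  by (simp add: trace_def homogeneous_of_sum)

lemma homogeneous_of_generic: "homogeneous_of 1 (generic l $ i $ j)"
  by (simp add: homogeneous_of_def generic_def Var_def monomial_degree_def)

lemma homogeneous_of_generic0: "homogeneous_of 1 (generic0 l $ i $ j)"
proof -
  have "homogeneous_of 1 (- (Const (1/3) * trace (generic l)))"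
    using homogeneous_of_scale[OF homogeneous_of_Const[of "- (1/3)"]
        homogeneous_of_trace[OF homogeneous_of_generic], of l]
    by (simp add: Const_arith)
  moreover have eq: "generic0 l $ i $ j = generic l $ i $ j
      + (if i = j then - (Const (1/3) * trace (generic l)) else 0)"
    by (simp add: generic0_shift(1) mat_def)
  ultimately show ?thesis
    unfolding eq using homogeneous_of_zero by (intro homogeneous_of_add homogeneous_of_generic) auto
qed

text \<open>The multidegree of a row. The first word represents all of them, by
  \<open>mset_t_rows\<close>.\<close>

definition content :: "(int \<times> letter list) list \<Rightarrow> letter multiset" where
  "content L = mset (snd (hd L))"

lemma mset_t_rows: "L \<in> set t_rows \<Longrightarrow> (c, w) \<in> set L \<Longrightarrow> mset w = content L"
proof -
  have "\<forall>L \<in> set t_rows. \<forall>(c, w) \<in> set L. mset w = mset (snd (hd L))"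
    by code_simp
  then show "L \<in> set t_rows \<Longrightarrow> (c, w) \<in> set L \<Longrightarrow> mset w = content L"
    unfolding content_def by blast
qed

lemma homogeneous_t_list:
  assumes "p \<in> set t_list"
  shows "homogeneous p"
proof -
  \<comment> \<open>The induction runs over a part \<open>K\<close> of the row while the degree
    stays that of \<open>L\<close>.\<close>
  have "homogeneous_of (size (content L)) (\<Sum>(c, w)\<leftarrow>K. of_int c * trace (word_mat generic0 w))"
    if "L \<in> set t_rows" "set K \<subseteq> set L" for L K
    using that(2)
  proof (induction K)
    case (Cons a K)
    have "size (content L) = length (snd a)"
      using mset_t_rows[OF that(1), of "fst a" "snd a"] Cons.prems
          by (metis insert_subset list.simps(15) prod.collapse size_mset)
    then have "homogeneous_of (size (content L)) (of_int (fst a) * trace (word_mat generic0 (snd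
        a)))"
      by (metis homogeneous_of_scale homogeneous_of_of_int homogeneous_of_trace
          homogeneous_of_word_mat homogeneous_of_generic0)
    then show ?case
      using Cons by (simp add: split_beta homogeneous_of_add)
  qed (simp add: homogeneous_of_zero)
  moreover have "homogeneous_of 1 (tr [generic l])" for l
    using homogeneous_of_trace[OF homogeneous_of_generic] by (simp add: tr_def)
  ultimately show ?thesis
    using assms unfolding t_list_eq homogeneous_def homogeneous_of_def[symmetric] by fastforce
qed

section \<open>Graded evaluation\<close>

text \<open>The codomain is the polynomial ring in three variables that keep track of the multidegree;
  its monomials are multisets of letters.\<close>

definition letters_of :: "monomial \<Rightarrow> letter multiset" where
  "letters_of m = (\<Sum>v\<in>UNIV. replicate_mset (Poly_Mapping.lookup m v) (fst v))"

definition eval_monomial :: "(letter \<Rightarrow> complex^3^3) \<Rightarrow> monomial \<Rightarrow> complex" where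
  "eval_monomial P m = (\<Prod>(l, i, j)\<in>UNIV. (P l $ i $ j) ^ Poly_Mapping.lookup m (l, i, j))"

text \<open>The algebra homomorphism that sends the variable \<open>(l, i, j)\<close> to its value
  at \<open>P\<close> times the grading variable \<open>l\<close>. The coefficient at a multidegree
  is the value at \<open>P\<close> of the component of that multidegree.\<close>

definition graded_eval :: "(letter \<Rightarrow> complex^3^3) \<Rightarrow> mpoly \<Rightarrow> letter multiset \<Rightarrow>\<^sub>0 complex" where
  "graded_eval P p = (\<Sum>m\<in>Poly_Mapping.keys p.
     Poly_Mapping.single (letters_of m) (Poly_Mapping.lookup p m * eval_monomial P m))"

lemma letters_of_add: "letters_of (m + m') = letters_of m + letters_of m'"
proof -
  have "replicate_mset (a + b) x = replicate_mset a x + replicate_mset b x" for a b and x :: letter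
    by (induction a) auto
  then show ?thesis by (simp add: letters_of_def lookup_add sum.distrib)
qed

lemma eval_monomial_add: "eval_monomial P (m + m') = eval_monomial P m * eval_monomial P m'"
  by (simp add: eval_monomial_def lookup_add power_add split_beta prod.distrib)

context
  fixes P :: "letter \<Rightarrow> complex^3^3"
begin

lemma graded_eval_superset:
  assumes "finite K" "Poly_Mapping.keys p \<subseteq> K"
  shows "graded_eval P p = (\<Sum>m\<in>K.
     Poly_Mapping.single (letters_of m) (Poly_Mapping.lookup p m * eval_monomial P m))"
  unfolding graded_eval_def using assms
  by (intro sum.mono_neutral_left) (auto simp: in_keys_iff)

lemma graded_eval_add: "graded_eval P (p + q) = graded_eval P p + graded_eval P q"
proof -
  let ?K = "Poly_Mapping.keys p \<union> Poly_Mapping.keys q"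
  have "graded_eval P r = (\<Sum>m\<in>?K.
      Poly_Mapping.single (letters_of m) (Poly_Mapping.lookup r m * eval_monomial P m))"
    if "r \<in> {p, q, p + q}" for r
    by (rule graded_eval_superset) (use that Poly_Mapping.keys_add[of p q] in auto)
  then show ?thesis
    by (simp add: lookup_add distrib_right single_add sum.distrib)
qed

lemma graded_eval_single:
  "graded_eval P (Poly_Mapping.single m c) = Poly_Mapping.single (letters_of m) (c * eval_monomial
      P m)"
  by (cases "c = 0") (simp_all add: graded_eval_def)

lemma graded_eval_sum: "graded_eval P (sum f I) = (\<Sum>i\<in>I. graded_eval P (f i))"
  by (induction I rule: infinite_finite_induct) (simp_all add: graded_eval_add graded_eval_def[of
      P 0])

lemma monomial_expansion:
  "(\<Sum>m\<in>Poly_Mapping.keys p. Poly_Mapping.single m (Poly_Mapping.lookup p m)) = (p :: mpoly)"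
proof (rule poly_mapping_eqI)
  fix k
  have "(\<Sum>m\<in>Poly_Mapping.keys p. if m = k then Poly_Mapping.lookup p m else 0) =
      Poly_Mapping.lookup p k"
    by (simp add: in_keys_iff)
  then show "Poly_Mapping.lookup (\<Sum>m\<in>Poly_Mapping.keys p. Poly_Mapping.single m
      (Poly_Mapping.lookup p m)) k
      = Poly_Mapping.lookup p k"
    by (simp add: lookup_sum lookup_single when_def)
qed

text \<open>Expanding both factors into monomials reduces this to the multiplicativity of
  \<open>eval_monomial\<close> and the additivity of \<open>letters_of\<close>.\<close>

lemma graded_eval_mult: "graded_eval P (p * q) = graded_eval P p * graded_eval P q"
proof -
  let ?s = "\<lambda>p m. Poly_Mapping.single m (Poly_Mapping.lookup p m) :: mpoly"
  let ?K = "Poly_Mapping.keys"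
  have "p * q = (\<Sum>m\<in>?K p. ?s p m) * (\<Sum>m\<in>?K q. ?s q m)"
    by (simp only: monomial_expansion)
  also have "graded_eval P \<dots> = (\<Sum>m\<in>?K p. \<Sum>m'\<in>?K q. graded_eval P (?s p m * ?s q m'))"
    by (simp only: sum_product graded_eval_sum)
  also have "\<dots> = graded_eval P p * graded_eval P q"
    unfolding graded_eval_def[of P p] graded_eval_def[of P q] sum_product
    by (intro sum.cong refl)
      (simp add: mult_single graded_eval_single letters_of_add eval_monomial_add algebra_simps)
  finally show ?thesis .
qed

lemma graded_eval_Const: "graded_eval P (Const c) = Poly_Mapping.single {#} c"
  by (simp add: Const_def graded_eval_single letters_of_def eval_monomial_def split_beta)

lemma graded_eval_Var: "graded_eval P (Var (l, i, j)) = Poly_Mapping.single {#l#} (P l $ i $ j)"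
proof -
  have "(\<Sum>v\<in>UNIV. replicate_mset (Poly_Mapping.lookup (Poly_Mapping.single (l, i, j) 1) v) (fst
      v)) =
      (\<Sum>v\<in>UNIV. if v = (l, i, j) then {#l#} else {#})"
    by (intro sum.cong) (auto simp: lookup_single when_def)
  moreover have "(\<Prod>v\<in>UNIV. (P (fst v) $ fst (snd v) $ snd (snd v)) ^
        Poly_Mapping.lookup (Poly_Mapping.single (l, i, j) 1) v) =
      (\<Prod>v\<in>UNIV. if v = (l, i, j) then P l $ i $ j else 1)"
    by (intro prod.cong) (auto simp: lookup_single when_def)
  ultimately show ?thesis
    by (simp add: Var_def graded_eval_single letters_of_def eval_monomial_def split_beta)
qed

lemma graded_eval_generic: "graded_eval P (generic l $ i $ j) = Poly_Mapping.single {#l#} (P l $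
    i $ j)"
  by (simp add: generic_def graded_eval_Var)

lemma single_sum: "Poly_Mapping.single k (\<Sum>i\<in>I. f i) = (\<Sum>i\<in>I. Poly_Mapping.single k (f i ::
    complex))"
  by (induction I rule: infinite_finite_induct) (simp_all add: single_add)

lemma graded_eval_trace:
  assumes "\<And>i j. graded_eval P (A $ i $ j) = Poly_Mapping.single k (C $ i $ j)"
  shows "graded_eval P (trace A) = Poly_Mapping.single k (trace C)"
  by (simp add: trace_def graded_eval_sum assms single_sum)

lemma graded_eval_generic0:
  "graded_eval P (generic0 l $ i $ j) = Poly_Mapping.single {#l#} ((P l - mat (trace (P l) / 3)) $
      i $ j)"
proof -
  have "generic0 l $ i $ j = generic l $ i $ j + Const (if i = j then - (1/3) else 0) * trace
      (generic l)"
    by (simp add: generic0_shift(1) mat_def Const_arith)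
  then show ?thesis
    by (simp add: graded_eval_add graded_eval_mult graded_eval_Const graded_eval_generic
        graded_eval_trace[OF graded_eval_generic] mult_single mat_def flip: single_add)
qed

lemma graded_eval_word_mat:
  assumes "\<And>l i j. graded_eval P (M l $ i $ j) = Poly_Mapping.single {#l#} (N l $ i $ j)"
  shows "graded_eval P (word_mat M w $ i $ j) = Poly_Mapping.single (mset w) (word_mat N w $ i $ j)"
proof (induction w arbitrary: i j)
  case Nil
  then show ?case
    using graded_eval_Const[of 0] graded_eval_Const[of 1] by (simp add: mat_def Const_arith)
next
  case (Cons l w)
  have "graded_eval P (word_mat M (l # w) $ i $ j) =
      (\<Sum>k\<in>UNIV. Poly_Mapping.single {#l#} (N l $ i $ k) * Poly_Mapping.single (mset w) (word_mat N
          w $ k $ j))"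
    by (simp add: matrix_matrix_mult_def graded_eval_sum graded_eval_mult assms Cons)
  then show ?case
    by (simp add: mult_single matrix_matrix_mult_def single_sum)
qed

definition traceless_point :: "letter \<Rightarrow> complex^3^3" where
  "traceless_point l = P l - mat (trace (P l) / 3)"

text \<open>A row is multihomogeneous, so its graded value is a single term.\<close>

lemma graded_eval_row:
  assumes "L \<in> set t_rows"
  shows "graded_eval P (\<Sum>(c, w)\<leftarrow>L. of_int c * trace (word_mat generic0 w)) =
    Poly_Mapping.single (content L) (\<Sum>(c, w)\<leftarrow>L. of_int c * trace (word_mat traceless_point w))"
proof -
  have row: "graded_eval P (of_int c * trace (word_mat generic0 w)) =
      Poly_Mapping.single (mset w) (of_int c * trace (word_mat traceless_point w))" for c w
  proof -
    have "graded_eval P (trace (word_mat generic0 w)) = Poly_Mapping.single (mset w) (trace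
        (word_mat traceless_point w))"
      by (intro graded_eval_trace graded_eval_word_mat) (simp add: graded_eval_generic0
          traceless_point_def)
    then show ?thesis
      by (simp add: graded_eval_mult graded_eval_Const mult_single flip: Const_arith(6) del:
          single_of_int)
  qed
  have "graded_eval P (\<Sum>(c, w)\<leftarrow>K. of_int c * trace (word_mat generic0 w)) =
      Poly_Mapping.single (content L) (\<Sum>(c, w)\<leftarrow>K. of_int c * trace (word_mat traceless_point w))"
    if "set K \<subseteq> set L" for K
    using that
  proof (induction K)
    case Nil
    then show ?case by (simp add: graded_eval_def)
  next
    case (Cons a K)
    then show ?case
      using mset_t_rows[OF assms, of "fst a" "snd a"]
      by (auto simp: split_beta graded_eval_add row single_add)
  qed
  then show ?thesis by blast
qed

text \<open>A product of two polynomials without constant term has no component of multidegree \<open>d\<close> if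
  neither factor has a component of total degree at most \<open>size d / 2\<close>.\<close>

definition avoiding :: "letter multiset \<Rightarrow> mpoly set" where
  "avoiding d = {p. \<forall>e \<in> Poly_Mapping.keys (graded_eval P p). e \<noteq> d \<and>
      (e = {#} \<or> 2 * size e > size d)}"

lemma subalgebra_avoiding:
  assumes "d \<noteq> {#}"
  shows "subalgebra (avoiding d)"
proof -
  have "p * q \<in> avoiding d" if "p \<in> avoiding d" "q \<in> avoiding d" for p q
  proof -
    have "e \<noteq> d \<and> (e = {#} \<or> 2 * size e > size d)"
      if e: "e \<in> Poly_Mapping.keys (graded_eval P (p * q))" for e
    proof -
      obtain a b where ab: "e = a + b" "a \<in> Poly_Mapping.keys (graded_eval P p)"
          "b \<in> Poly_Mapping.keys (graded_eval P q)"
        using e keys_mult unfolding graded_eval_mult by blast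
      then have "a \<noteq> d \<and> (a = {#} \<or> 2 * size a > size d)" "b \<noteq> d \<and> (b = {#} \<or> 2 * size b > size d)"
        using \<open>p \<in> avoiding d\<close> \<open>q \<in> avoiding d\<close> by (auto simp: avoiding_def)
      \<comment> \<open>If neither \<open>a\<close> nor \<open>b\<close> is empty, both sizes exceed
        half that of \<open>d\<close>, so \<open>a + b\<close> is larger than
        \<open>d\<close>.\<close>
      then show ?thesis
        unfolding ab(1) by (cases "a = {#}"; cases "b = {#}") auto
    qed
    then show ?thesis by (simp add: avoiding_def)
  qed
  moreover have "p + q \<in> avoiding d" if p: "p \<in> avoiding d" and q: "q \<in> avoiding d" for p q
    unfolding avoiding_def mem_Collect_eq
  proof
    fix e
    assume "e \<in> Poly_Mapping.keys (graded_eval P (p + q))"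
    from subsetD[OF Poly_Mapping.keys_add this[unfolded graded_eval_add]]
    consider "e \<in> Poly_Mapping.keys (graded_eval P p)" | "e \<in> Poly_Mapping.keys (graded_eval P q)"
      by auto
    then show "e \<noteq> d \<and> (e = {#} \<or> 2 * size e > size d)"
      using p q unfolding avoiding_def by cases blast+
  qed
  moreover have "Const c \<in> avoiding d" for c
    using assms by (auto simp: avoiding_def graded_eval_Const)
  ultimately show ?thesis by (simp add: subalgebra_def)
qed

end

section \<open>Minimality\<close>

datatype mat9 = Mat9 int int int int int int int int int

primrec entries :: "mat9 \<Rightarrow> complex^3^3" where
  "entries (Mat9 a b c d e f g h k) = vector [vector [of_int a, of_int b, of_int c],
     vector [of_int d, of_int e, of_int f], vector [of_int g, of_int h, of_int k]]"

fun mult9 :: "mat9 \<Rightarrow> mat9 \<Rightarrow> mat9" where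
  "mult9 (Mat9 a b c d e f g h k) (Mat9 a' b' c' d' e' f' g' h' k') =
     Mat9 (a * a' + b * d' + c * g') (a * b' + b * e' + c * h') (a * c' + b * f' + c * k')
       (d * a' + e * d' + f * g') (d * b' + e * e' + f * h') (d * c' + e * f' + f * k')
       (g * a' + h * d' + k * g') (g * b' + h * e' + k * h') (g * c' + h * f' + k * k')"

primrec trace9 :: "mat9 \<Rightarrow> int" where
  "trace9 (Mat9 a b c d e f g h k) = a + e + k"

definition word9 :: "(letter \<Rightarrow> mat9) \<Rightarrow> letter list \<Rightarrow> mat9" where
  "word9 P w = foldr (mult9 \<circ> P) w (Mat9 1 0 0 0 1 0 0 0 1)"

lemma entries_mult9: "entries (mult9 A B) = entries A ** entries B"
  by (cases A; cases B) (simp add: vec_eq_iff forall_3 matrix_matrix_mult_def sum_3)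

lemma entries_word9: "entries (word9 P w) = word_mat (\<lambda>l. entries (P l)) w"
proof (induction w)
  case Nil
  then show ?case by (simp add: word9_def vec_eq_iff forall_3 mat_def)
next
  case (Cons l w)
  then show ?case by (simp add: word9_def entries_mult9)
qed

lemma trace_entries: "trace (entries A) = of_int (trace9 A)"
  by (cases A) (simp add: trace_def sum_3)

definition value9 :: "(letter \<Rightarrow> mat9) \<Rightarrow> nat \<Rightarrow> int" where
  "value9 P i = (\<Sum>(c, w)\<leftarrow>t_rows ! i. c * trace9 (word9 P w))"

lemma value9:
  "(\<Sum>(c, w)\<leftarrow>t_rows ! i. of_int c * trace (word_mat (\<lambda>l. entries (P l)) w)) = of_int (value9 P i)"
proof -
  have "(\<Sum>(c, w)\<leftarrow>L. of_int c * trace (word_mat (\<lambda>l. entries (P l)) w)) =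
      of_int (\<Sum>(c, w)\<leftarrow>L. c * trace9 (word9 P w))" for L
    by (induction L) (auto simp: trace_entries simp flip: entries_word9)
  then show ?thesis by (simp add: value9_def)
qed

text \<open>A computable condition that puts every generator except row \<open>i\<close> into
  \<open>avoiding\<close>. Zero traces make the point equal to its traceless part and let the three
  linear generators vanish.\<close>

definition isolates :: "(letter \<Rightarrow> mat9) \<Rightarrow> nat \<Rightarrow> bool" where
  "isolates P i \<longleftrightarrow> (\<forall>l \<in> set alphabet. trace9 (P l) = 0) \<and> value9 P i \<noteq> 0 \<and>
     (\<forall>j \<in> set (filter (\<lambda>j. j \<noteq> i \<and>
         (content (t_rows ! j) = content (t_rows ! i) \<or>
          2 * length (snd (hd (t_rows ! j))) \<le> length (snd (hd (t_rows ! i))))) [0..<45]).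
       value9 P j = 0)"

definition point :: "mat9 \<Rightarrow> mat9 \<Rightarrow> mat9 \<Rightarrow> letter \<Rightarrow> mat9" where
  "point x y z l = (case l of LX \<Rightarrow> x | LY \<Rightarrow> y | LZ \<Rightarrow> z)"

text \<open>The point for the rows 17 to 22 and 35 to 44 consists of odd matrices of the Lie superalgebra
  \<open>osp(1|2)\<close>, where all traces of words of length at most 3 vanish; the point for row 16 consists
  of skew-symmetric matrices. The points for the rows 23 to 34 were found by a search among
  triples that span an isotropic subspace for the trace form.\<close>

definition points :: "((letter \<Rightarrow> mat9) \<times> nat list) list" where
  "points = [
     (\<lambda>_. Mat9 1 0 0  0 (-1) 0  0 0 0, [0..<6]),
     (\<lambda>_. Mat9 1 0 0  0 1 0  0 0 (-2), [6..<16]),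
     (point (Mat9 0 0 0  0 0 1  0 (-1) 0) (Mat9 0 0 1  0 0 0  (-1) 0 0)
        (Mat9 0 1 0  (-1) 0 0  0 0 0), [16]),
     (point (Mat9 0 0 1  0 0 0  0 1 0) (Mat9 0 0 0  0 0 1  (-1) 0 0)
        (Mat9 0 0 1  0 0 1  (-1) 1 0), [17..<23] @ [35..<45]),
     (point (Mat9 0 0 (-1)  0 1 0  1 0 (-1)) (Mat9 0 (-1) 0  0 0 1  0 0 0)
        (Mat9 0 (-1) 0  0 0 (-1)  0 0 0), [23]),
     (point (Mat9 0 (-1) 0  0 0 1  0 0 0) (Mat9 0 0 (-1)  0 1 0  1 0 (-1))
        (Mat9 0 (-1) 0  0 0 (-1)  0 0 0), [24]),
     (point (Mat9 0 (-1) 0  0 0 1  0 0 0) (Mat9 0 (-1) 0  0 0 (-1)  0 0 0)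
        (Mat9 0 0 (-1)  0 1 0  1 0 (-1)), [25]),
     (point (Mat9 0 0 1  (-1) 0 0  0 0 0) (Mat9 0 0 (-1)  1 0 0  0 1 0)
        (Mat9 0 1 (-1)  1 0 0  1 0 0), [26..<32]),
     (point (Mat9 0 0 1  (-1) 0 1  0 0 0) (Mat9 0 0 (-1)  0 (-1) 0  1 (-1) 1)
        (Mat9 0 (-1) 0  0 0 0  0 (-1) 0), [32]),
     (point (Mat9 0 0 1  (-1) 0 1  0 0 0) (Mat9 0 (-1) 0  0 0 0  0 (-1) 0)
        (Mat9 0 0 (-1)  0 (-1) 0  1 (-1) 1), [33]),
     (point (Mat9 0 (-1) 0  0 0 0  0 (-1) 0) (Mat9 0 0 1  (-1) 0 1  0 0 0)
        (Mat9 0 0 (-1)  0 (-1) 0  1 (-1) 1), [34])]"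

text \<open>At the diagonal points the three letters coincide: rows of degree two become tr(A^2) =
  2, those of degree three nonzero multiples of tr(A^3) = -6, except row 16, which vanishes by
  commutativity. At skew-symmetric matrices tr(xyz) = -tr(xzy), so row 15 vanishes. All points are
  verified by evaluation.\<close>

lemma points_isolate: "\<forall>(P, I) \<in> set points. \<forall>i \<in> set I. isolates P i"
  by code_simp

lemma exists_isolating_point:
  assumes "i < 45"
  obtains P where "isolates P i"
proof -
  have "\<forall>i \<in> set [0..<45]. \<exists>(P, I) \<in> set points. i \<in> set I"
    by (simp add: points_def upt_rec)
  with assms points_isolate that show ?thesis
    by fastforce
qed

lemma length_t_rows: "length t_rows = 45"
  by (simp add: t_rows_def)

lemma size_content: "size (content L) = length (snd (hd L))"
  by (simp add: content_def)

lemma size_content_ge: "L \<in> set t_rows \<Longrightarrow> size (content L) \<ge> 2"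
proof -
  have "\<forall>L \<in> set t_rows. length (snd (hd L)) \<ge> 2" by code_simp
  then show "L \<in> set t_rows \<Longrightarrow> size (content L) \<ge> 2" by (simp add: size_content)
qed

section \<open>Separating subalgebras\<close>

definition row :: "nat \<Rightarrow> mpoly" where
  "row i = (\<Sum>(c, w)\<leftarrow>t_rows ! i. of_int c * trace (word_mat generic0 w))"

lemma t_list_nth:
  "i < 3 \<Longrightarrow> t_list ! i = trace (generic (alphabet ! i))"
  "i < 45 \<Longrightarrow> t_list ! (i + 3) = row i"
  by (auto simp: t_list_eq tr_def nth_append length_t_rows row_def alphabet_def less_Suc_eq
      numeral_3_eq_3)

lemma length_t_list: "length t_list = 48"
  by (simp add: t_list_eq length_t_rows)

lemma graded_eval_trace_generic:
  "graded_eval P (trace (generic l)) = Poly_Mapping.single {#l#} (trace (P l))"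
  by (rule graded_eval_trace) (rule graded_eval_generic)

lemma index_cases:
  assumes "j < (48 :: nat)"
  obtains "j < 3" | i where "i < 45" "j = i + 3"
  using assms that(2)[of "j - 3"] that(1) by (cases "j < 3") auto

lemma separation_row:
  assumes i: "i < 45"
  shows "\<exists>B. subalgebra B \<and> t_list ! (i + 3) \<notin> B \<and> (\<forall>j<48. j \<noteq> i + 3 \<longrightarrow> t_list ! j \<in> B)"
proof -
  obtain P where P: "isolates P i" using exists_isolating_point[OF i] .
  define Q where "Q = (\<lambda>l. entries (P l))"
  define d where "d = content (t_rows ! i)"
  have tr0: "trace (Q l) = 0" for l
    using P letter_in_alphabet[of l] by (simp add: isolates_def Q_def trace_entries)
  have "traceless_point Q = Q"
    by (rule ext) (simp add: traceless_point_def tr0 vec_eq_iff mat_def)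
  then have ev: "graded_eval Q (row j) = Poly_Mapping.single (content (t_rows ! j)) (of_int
      (value9 P j))"
    if "j < 45" for j
    unfolding row_def using that graded_eval_row[of "t_rows ! j" Q] value9[of P j, folded Q_def]
    by (simp add: length_t_rows)
  have "d \<noteq> {#}"
    using size_content_ge[of "t_rows ! i"] i by (auto simp: d_def length_t_rows)
  moreover have "t_list ! (i + 3) \<notin> avoiding Q d"
    using P i by (simp add: t_list_nth avoiding_def ev d_def isolates_def)
  moreover have "t_list ! j \<in> avoiding Q d" if j: "j < 48" "j \<noteq> i + 3" for j
    using j(1)
  proof (cases rule: index_cases)
    case 1
    then show ?thesis by (simp add: t_list_nth avoiding_def graded_eval_trace_generic tr0)
  next
    case (2 k)
    \<comment> \<open>A row with nonzero value differs from \<open>d\<close> in multidegree and has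
      more than half its degree, as \<open>avoiding\<close> demands.\<close>
    then have "value9 P k = 0 \<or> content (t_rows ! k) \<noteq> d \<and> 2 * size (content (t_rows ! k)) > size d"
      using P j(2) by (auto simp: isolates_def d_def size_content not_less)
    then show ?thesis
      using 2 by (auto simp: t_list_nth avoiding_def ev)
  qed
  ultimately show ?thesis
    using subalgebra_avoiding by blast
qed

lemma separation_trace:
  assumes "i < 3"
  shows "\<exists>B. subalgebra B \<and> t_list ! i \<notin> B \<and> (\<forall>j<48. j \<noteq> i \<longrightarrow> t_list ! j \<in> B)"
proof -
  define l where "l = alphabet ! i"
  \<comment> \<open>With scalar matrices all traceless parts vanish, hence so do all rows; of the
    three traces only that of \<open>l\<close> survives.\<close>
  define Q :: "letter \<Rightarrow> complex^3^3" where "Q k = (if k = l then mat 1 else 0)" for k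
  have 0: "traceless_point Q k = 0" for k
    by (simp add: traceless_point_def Q_def trace_one vec_eq_iff mat_def trace_def)
  have W0: "word_mat (traceless_point Q) w = 0" if "w \<noteq> []" for w
    using that by (cases w) (simp_all add: 0 matrix_matrix_mult_def vec_eq_iff)
  have ev: "graded_eval Q (row j) = 0" if j: "j < 45" for j
  proof -
    have L: "t_rows ! j \<in> set t_rows" using j by (simp add: length_t_rows)
    have "w \<noteq> []" if "(c, w) \<in> set (t_rows ! j)" for c w
      using mset_t_rows[OF L that] size_content_ge[OF L] by auto
    then have "(\<Sum>(c, w)\<leftarrow>t_rows ! j. of_int c * trace (word_mat (traceless_point Q) w)) =
        (\<Sum>x\<leftarrow>t_rows ! j. 0)"
      by (intro arg_cong[of _ _ sum_list] map_cong refl) (auto simp: W0 trace_def)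
    then show ?thesis
      unfolding row_def graded_eval_row[OF L] by simp
  qed
  have "t_list ! i \<notin> avoiding Q {#l#}"
    by (simp add: t_list_nth assms avoiding_def l_def[symmetric] graded_eval_trace_generic Q_def
        trace_one)
  moreover have "t_list ! j \<in> avoiding Q {#l#}" if j: "j < 48" "j \<noteq> i" for j
    using j(1)
  proof (cases rule: index_cases)
    case 1
    then have "alphabet ! j \<noteq> l"
      using assms j(2) nth_eq_iff_index_eq[of alphabet j i] by (simp add: alphabet_def l_def)
    then have "trace (Q (alphabet ! j)) = 0"
      by (simp add: Q_def trace_def)
    then show ?thesis
      by (simp add: t_list_nth 1 avoiding_def graded_eval_trace_generic)
  next
    case (2 k)
    then show ?thesis by (simp add: t_list_nth avoiding_def ev)
  qed
  ultimately show ?thesis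
    using subalgebra_avoiding[of "{#l#}" Q] by (intro exI[of _ "avoiding Q {#l#}"]) simp
qed

text \<open>Yields both that the 48 entries are distinct and that none can be omitted.\<close>

theorem separation:
  assumes "i < 48"
  shows "\<exists>B. subalgebra B \<and> t_list ! i \<notin> B \<and> (\<forall>j<48. j \<noteq> i \<longrightarrow> t_list ! j \<in> B)"
  using assms
proof (cases rule: index_cases)
  case 1
  then show ?thesis by (rule separation_trace)
next
  case (2 k)
  then show ?thesis using separation_row by simp
qed

theorem lemma3p2:
  shows "card (set t_list) = 48 \<and> minimal_generating_set C33 (set t_list)"
proof
  have "distinct t_list"
    unfolding distinct_conv_nth length_t_list using separation by metis
  then show "card (set t_list) = 48"
    by (simp add: distinct_card length_t_list)
  have "subalgebra hull S \<noteq> C33" if S: "S \<subset> set t_list" for S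
  proof
    assume hull: "subalgebra hull S = C33"
    from S obtain i where i: "i < 48" "t_list ! i \<notin> S"
      by (metis in_set_conv_nth length_t_list psubset_imp_ex_mem DiffE)
    obtain B where B: "subalgebra B" "t_list ! i \<notin> B" "\<forall>j<48. j \<noteq> i \<longrightarrow> t_list ! j \<in> B"
      using separation[OF i(1)] by blast
    \<comment> \<open>The separating subalgebra of an omitted generator contains \<open>S\<close>,
      hence all that \<open>S\<close> generates, but not that generator.\<close>
    have "S \<subseteq> B"
    proof
      fix p
      assume "p \<in> S"
      with S obtain j where "j < 48" "p = t_list ! j"
        by (metis in_set_conv_nth length_t_list psubsetD)
      with \<open>p \<in> S\<close> i B(3) show "p \<in> B" by metis
    qed
    then have "C33 \<subseteq> B" using B(1) hull hull_minimal by metis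
    moreover have "t_list ! i \<in> C33"
      using hull_subset[of "set t_list" subalgebra] i(1) by (auto simp: hull_t_list length_t_list)
    ultimately show False using B(2) by blast
  qed
  moreover have "set t_list \<subseteq> C33"
    using hull_subset[of "set t_list" subalgebra] by (simp add: hull_t_list)
  ultimately show "minimal_generating_set C33 (set t_list)"
    using homogeneous_t_list hull_t_list by (simp add: minimal_generating_set_def)
qed

end
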